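(* Let $M_i^u$ and $M_j^v$ be the indecomposable $\mathrm{u}_q^+$-modules attached to $i,j\in\mathbb{Z}/d\mathbb{Z}$ and integers $0\le u,v\le d-1$. There are isomorphisms of $\mathrm{u}_q^+$-modules: 1. If $u+v\le d-1$, then $$M_i^u\otimes M_j^v\cong\bigoplus_{l=0}^{\min(u,v)}M_{i+j+l}^{u+v-2l}.$$ 2. If $u+v\ge d-1$, set $e=u+v-(d-1)$; then $$M_i^u\otimes M_j^v\cong\bigoplus_{l=0}^{e}P_{i+j+l}\oplus\bigoplus_{l=e+1}^{\min(u,v)}M_{i+j+l}^{u+v-2l}.$$
   Context: Let $q\in\mathbb{C}$ be a primitive $n$-th root of unity with $n\ge 3$, $n\ne 4$, and set $d=n$ if $n$ is odd, $d=n/2$ if $n$ is even. The Hopf algebra $\mathrm{u}_q^+$ is the $\mathbb{C}$-algebra generated by $E,K$ with relations $E^d=0$, $K^d=1$, $KE=q^2EK$, with basis $\{E^iK^j\}_{0\le i,j\le d-1}$, comultiplication $\Delta(E)=1\otimes E+E\otimes K$, $\Delta(K)=K\otimes K$, counit $\epsilon(E)=0$, $\epsilon(K)=1$, and antipode $S(E)=-EK^{-1}$, $S(K)=K^{-1}$. The tensor product over $\mathbb{C}$ of two left modules is a left module through $\Delta$. For $i\in\mathbb{Z}/d\mathbb{Z}$ and $0\le u\le d-1$, $M_i^u$ is the $\mathrm{u}_q^+$-module with $\mathbb{C}$-basis $e_i^0,\dots,e_i^u$ and action $Ke_i^j=q^{2(i+j)}e_i^j$, $Ee_i^j=e_i^{j+1}$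 for $0\le j\le u-1$, $Ee_i^u=0$. These form a complete list of pairwise non-isomorphic indecomposable $\mathrm{u}_q^+$-modules. Write $P_i=M_i^{d-1}$ (the indecomposable projective modules). Empty direct sums are zero. *)

theory Defs
  imports Complex_Main "HOL-Algebra.Ring"
begin

definition primitive_root_unity :: "nat \<Rightarrow> complex \<Rightarrow> bool" where
  "primitive_root_unity n q \<longleftrightarrow> n > 0 \<and> q ^ n = 1 \<and> (\<forall>m. 0 < m \<and> m < n \<longrightarrow> q ^ m \<noteq> 1)"

section \<open>Complex vector spaces with a finite basis\<close>

text \<open>A finite-dimensional vector space with basis indexed by a finite set \<open>B\<close> is represented by
  its coordinates, i.e. as the space of functions that vanish off \<open>B\<close>. In this representation
  \<open>linext A f\<close> is the linear map that sends the basis vector of index \<open>a \<in> A\<close> to \<open>f a\<close>, and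
  the tensor product of the spaces over \<open>A\<close> and \<open>B\<close> is the space over \<open>A \<times> B\<close>, with the
  bilinear map \<open>tens\<close> into it.\<close>

definition cspace :: "'a set \<Rightarrow> ('a \<Rightarrow> complex) set" where
  "cspace B = {x. \<forall>b. b \<notin> B \<longrightarrow> x b = 0}"

definition vadd :: "('a \<Rightarrow> complex) \<Rightarrow> ('a \<Rightarrow> complex) \<Rightarrow> 'a \<Rightarrow> complex" where
  "vadd x y = (\<lambda>a. x a + y a)"

definition vscale :: "complex \<Rightarrow> ('a \<Rightarrow> complex) \<Rightarrow> 'a \<Rightarrow> complex" where
  "vscale c x = (\<lambda>a. c * x a)"

definition vzero :: "'a \<Rightarrow> complex" where
  "vzero = (\<lambda>_. 0)"

definition bvec :: "'a \<Rightarrow> 'a \<Rightarrow> complex" where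
  "bvec b = (\<lambda>a. if a = b then 1 else 0)"

definition linext :: "'a set \<Rightarrow> ('a \<Rightarrow> 'b \<Rightarrow> complex) \<Rightarrow> ('a \<Rightarrow> complex) \<Rightarrow> 'b \<Rightarrow> complex" where
  "linext A f x = (\<lambda>b. \<Sum>a\<in>A. x a * f a b)"

definition tens :: "('a \<Rightarrow> complex) \<Rightarrow> ('b \<Rightarrow> complex) \<Rightarrow> 'a \<times> 'b \<Rightarrow> complex" where
  "tens x y = (\<lambda>(a, b). x a * y b)"

lemma cspaceI: "(\<And>b. b \<notin> B \<Longrightarrow> x b = 0) \<Longrightarrow> x \<in> cspace B"
  by (simp add: cspace_def)

lemma cspace_simps [simp]:
  "vzero \<in> cspace B" "x \<in> cspace B \<Longrightarrow> y \<in> cspace B \<Longrightarrow> vadd x y \<in> cspace B"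
  "x \<in> cspace B \<Longrightarrow> vscale c x \<in> cspace B" "b \<in> B \<Longrightarrow> bvec b \<in> cspace B"
  by (auto simp: cspace_def vzero_def vadd_def vscale_def bvec_def)

lemma vscale_1 [simp]: "vscale 1 x = x"
  by (simp add: vscale_def)

lemma linext_cspace: "(\<And>a. a \<in> A \<Longrightarrow> f a \<in> cspace B) \<Longrightarrow> linext A f x \<in> cspace B"
  by (auto simp: cspace_def linext_def intro!: sum.neutral)

lemma linext_cong: "(\<And>a. a \<in> A \<Longrightarrow> f a = g a) \<Longrightarrow> linext A f x = linext A g x"
  by (simp add: linext_def)

lemma linext_vadd: "linext A f (vadd x y) = vadd (linext A f x) (linext A f y)"
  by (simp add: linext_def vadd_def sum.distrib algebra_simps)

lemma linext_vadd_fun: "linext A (\<lambda>a. vadd (f a) (g a)) x = vadd (linext A f x) (linext A g x)"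
  by (simp add: linext_def vadd_def sum.distrib algebra_simps)

lemma linext_vscale: "linext A f (vscale c x) = vscale c (linext A f x)"
  by (simp add: linext_def vscale_def sum_distrib_left algebra_simps)

lemma linext_vscale_fun: "linext A (\<lambda>a. vscale c (f a)) x = vscale c (linext A f x)"
  by (simp add: linext_def vscale_def sum_distrib_left algebra_simps)

lemma linext_vzero: "linext A f vzero = vzero" "linext A (\<lambda>_. vzero) x = vzero"
  by (simp_all add: linext_def vzero_def)

lemma linext_bvec: "finite A \<Longrightarrow> a \<in> A \<Longrightarrow> linext A f (bvec a) = f a"
  by (simp add: linext_def bvec_def if_distrib [of "\<lambda>c. c * _"] cong: if_cong)

lemma linext_id:
  assumes "finite A" "x \<in> cspace A"
  shows "linext A bvec x = x"
proof
  fix b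
  have "linext A bvec x b = (\<Sum>a\<in>A. if b = a then x a else 0)"
    unfolding linext_def by (rule sum.cong) (simp_all add: bvec_def)
  then show "linext A bvec x b = x b"
    using assms by (auto simp: cspace_def)
qed

lemma linext_linext: "linext B g (linext A f x) = linext A (\<lambda>a. linext B g (f a)) x"
proof
  fix c
  have "linext B g (linext A f x) c = (\<Sum>b\<in>B. \<Sum>a\<in>A. x a * f a b * g b c)"
    by (simp add: linext_def sum_distrib_right)
  also have "\<dots> = (\<Sum>a\<in>A. \<Sum>b\<in>B. x a * f a b * g b c)"
    by (rule sum.swap)
  finally show "linext B g (linext A f x) c = linext A (\<lambda>a. linext B g (f a)) x c"
    by (simp add: linext_def sum_distrib_left mult.assoc)
qed

section \<open>Algebras with a finite basis, and their modules\<close>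

text \<open>The algebra with underlying space \<open>cspace B\<close> in which the basis vectors of index \<open>p\<close> and \<open>r\<close>
  have product \<open>m p r\<close>.\<close>

definition based_alg :: "'b set \<Rightarrow> ('b \<Rightarrow> 'b \<Rightarrow> 'b \<Rightarrow> complex) \<Rightarrow> ('b \<Rightarrow> complex) \<Rightarrow> ('b \<Rightarrow> complex) ring"
  where
  "based_alg B m e =
     \<lparr>carrier = cspace B, mult = (\<lambda>x y. linext B (\<lambda>p. linext B (m p) y) x), one = e,
      zero = vzero, add = vadd\<rparr>"

lemma based_alg_sel [simp]:
  "carrier (based_alg B m e) = cspace B"
  "x \<otimes>\<^bsub>based_alg B m e\<^esub> y = linext B (\<lambda>p. linext B (m p) y) x"
  "\<one>\<^bsub>based_alg B m e\<^esub> = e" "\<zero>\<^bsub>based_alg B m e\<^esub> = vzero" "x \<oplus>\<^bsub>based_alg B m e\<^esub> y = vadd x y"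
  by (simp_all add: based_alg_def)

lemma based_alg_ring:
  assumes B: "finite B" and e: "e \<in> cspace B"
    and m: "\<And>p r. p \<in> B \<Longrightarrow> r \<in> B \<Longrightarrow> m p r \<in> cspace B"
    and assoc: "\<And>p r s. p \<in> B \<Longrightarrow> r \<in> B \<Longrightarrow> s \<in> B \<Longrightarrow>
      linext B (\<lambda>t. m t s) (m p r) = linext B (m p) (m r s)"
    and unit: "\<And>p. p \<in> B \<Longrightarrow> linext B (m p) e = bvec p" "\<And>p. p \<in> B \<Longrightarrow> linext B (\<lambda>t. m t p) e = bvec p"
  shows "ring (based_alg B m e)"
proof -
  have swap: "linext B (\<lambda>p. linext B (m p) y) x = linext B (\<lambda>r. linext B (\<lambda>p. m p r) x) y" for x y
    by (auto simp: linext_def sum_distrib_left mult.left_commute fun_eq_iff intro: sum.swap [THEN trans])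
  have assoc': "linext B (\<lambda>s. linext B (m s) z) (m p r) = linext B (m p) (linext B (m r) z)"
    if "p \<in> B" "r \<in> B" for p r z
    using that by (simp add: swap linext_linext assoc cong: linext_cong)
  show ?thesis
  proof (rule ringI)
    show "abelian_group (based_alg B m e)"
    proof (rule abelian_groupI)
      fix x assume "x \<in> carrier (based_alg B m e)"
      then show "\<exists>y\<in>carrier (based_alg B m e). y \<oplus>\<^bsub>based_alg B m e\<^esub> x = \<zero>\<^bsub>based_alg B m e\<^esub>"
        by (intro bexI [of _ "vscale (- 1) x"]) (auto simp: vadd_def vscale_def vzero_def cspace_def)
    qed (auto simp: cspace_def vadd_def vzero_def algebra_simps)
    show "monoid (based_alg B m e)"
    proof (rule monoidI)
      fix x y assume "x \<in> carrier (based_alg B m e)" "y \<in> carrier (based_alg B m e)"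
      then show "x \<otimes>\<^bsub>based_alg B m e\<^esub> y \<in> carrier (based_alg B m e)"
        by (auto intro!: linext_cspace m)
    next
      fix x y z
      show "x \<otimes>\<^bsub>based_alg B m e\<^esub> y \<otimes>\<^bsub>based_alg B m e\<^esub> z =
        x \<otimes>\<^bsub>based_alg B m e\<^esub> (y \<otimes>\<^bsub>based_alg B m e\<^esub> z)"
        by (simp add: linext_linext assoc' cong: linext_cong)
    next
      fix x assume x: "x \<in> carrier (based_alg B m e)"
      show "\<one>\<^bsub>based_alg B m e\<^esub> \<otimes>\<^bsub>based_alg B m e\<^esub> x = x"
        using x B by (simp add: swap unit linext_id cong: linext_cong)
      show "x \<otimes>\<^bsub>based_alg B m e\<^esub> \<one>\<^bsub>based_alg B m e\<^esub> = x"
        using x B by (simp add: unit linext_id cong: linext_cong)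
    qed (use e in auto)
  qed (auto simp: linext_vadd linext_vadd_fun)
qed

definition tensor_alg ::
    "'a set \<Rightarrow> ('a \<Rightarrow> complex) ring \<Rightarrow> 'b set \<Rightarrow> ('b \<Rightarrow> complex) ring \<Rightarrow> ('a \<times> 'b \<Rightarrow> complex) ring"
  where
  "tensor_alg A R B S = based_alg (A \<times> B)
     (\<lambda>(p, r) (p', r'). tens (bvec p \<otimes>\<^bsub>R\<^esub> bvec p') (bvec r \<otimes>\<^bsub>S\<^esub> bvec r'))
     (tens \<one>\<^bsub>R\<^esub> \<one>\<^bsub>S\<^esub>)"

record ('b, 'a) fdmod =
  idx :: "'a set"
  act :: "('b \<Rightarrow> complex) \<Rightarrow> ('a \<Rightarrow> complex) \<Rightarrow> 'a \<Rightarrow> complex"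

definition space :: "('b, 'a) fdmod \<Rightarrow> ('a \<Rightarrow> complex) set" where
  "space V = cspace (idx V)"

definition is_left_module :: "('b \<Rightarrow> complex) ring \<Rightarrow> ('b, 'a) fdmod \<Rightarrow> bool" where
  "is_left_module R V \<longleftrightarrow>
     finite (idx V) \<and>
     (\<forall>h\<in>carrier R. \<forall>x\<in>space V. act V h x \<in> space V) \<and>
     (\<forall>h\<in>carrier R. \<forall>x\<in>space V. \<forall>y\<in>space V.
        act V h (vadd x y) = vadd (act V h x) (act V h y)) \<and>
     (\<forall>h\<in>carrier R. \<forall>g\<in>carrier R. \<forall>x\<in>space V.
        act V (h \<oplus>\<^bsub>R\<^esub> g) x = vadd (act V h x) (act V g x)) \<and>
     (\<forall>c. \<forall>h\<in>carrier R. \<forall>x\<in>space V.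
        act V h (vscale c x) = vscale c (act V h x) \<and>
        act V (vscale c h) x = vscale c (act V h x)) \<and>
     (\<forall>x\<in>space V. act V \<one>\<^bsub>R\<^esub> x = x) \<and>
     (\<forall>h\<in>carrier R. \<forall>g\<in>carrier R. \<forall>x\<in>space V.
        act V (h \<otimes>\<^bsub>R\<^esub> g) x = act V h (act V g x))"

text \<open>An isomorphism statement includes the claim that both sides are modules over \<open>R\<close>.\<close>

definition isomorphic_modules ::
    "('b \<Rightarrow> complex) ring \<Rightarrow> ('b, 'a) fdmod \<Rightarrow> ('b, 'c) fdmod \<Rightarrow> bool" where
  "isomorphic_modules R V W \<longleftrightarrow>
     is_left_module R V \<and> is_left_module R W \<and>
     (\<exists>\<phi>. bij_betw \<phi> (space V) (space W) \<and>
        (\<forall>x\<in>space V. \<forall>y\<in>space V. \<phi> (vadd x y) = vadd (\<phi> x) (\<phi> y)) \<and>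
        (\<forall>c. \<forall>x\<in>space V. \<phi> (vscale c x) = vscale c (\<phi> x)) \<and>
        (\<forall>h\<in>carrier R. \<forall>x\<in>space V. \<phi> (act V h x) = act W h (\<phi> x)))"

definition direct_sum :: "'i set \<Rightarrow> ('i \<Rightarrow> ('b, 'a) fdmod) \<Rightarrow> ('b, 'i \<times> 'a) fdmod" where
  "direct_sum I V =
     \<lparr>idx = Sigma I (\<lambda>l. idx (V l)),
      act = (\<lambda>h x (l, a). if l \<in> I then act (V l) h (\<lambda>b. x (l, b)) a else 0)\<rparr>"

definition direct_sum2 :: "('b, 'a) fdmod \<Rightarrow> ('b, 'c) fdmod \<Rightarrow> ('b, 'a + 'c) fdmod" where
  "direct_sum2 V W =
     \<lparr>idx = idx V <+> idx W,
      act = (\<lambda>h x. case_sum (act V h (\<lambda>a. x (Inl a))) (act W h (\<lambda>c. x (Inr c))))\<rparr>"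

text \<open>The module structure on \<open>V \<otimes> W\<close> through a comultiplication \<open>\<Delta>\<close> on an algebra with underlying
  space \<open>cspace B\<close>: the vector \<open>h\<close> acts by \<open>\<Delta> h\<close>, where \<open>g \<otimes> g'\<close> sends \<open>x \<otimes> y\<close> to \<open>gx \<otimes> g'y\<close>.\<close>

definition tensor_module ::
    "'b set \<Rightarrow> (('b \<Rightarrow> complex) \<Rightarrow> 'b \<times> 'b \<Rightarrow> complex) \<Rightarrow>
     ('b, 'a) fdmod \<Rightarrow> ('b, 'c) fdmod \<Rightarrow> ('b, 'a \<times> 'c) fdmod" where
  "tensor_module B \<Delta> V W =
     \<lparr>idx = idx V \<times> idx W,
      act = (\<lambda>h x. linext (B \<times> B)
        (\<lambda>(p, r). linext (idx V \<times> idx W)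
           (\<lambda>(a, c). tens (act V (bvec p) (bvec a)) (act W (bvec r) (bvec c))) x) (\<Delta> h))\<rparr>"

section \<open>The algebra generated by E and K\<close>

definition uq_ord :: "nat \<Rightarrow> nat" where
  "uq_ord n = (if odd n then n else n div 2)"

text \<open>The basis vector of index \<open>(a, b)\<close> is \<open>E\<^sup>a K\<^sup>b\<close>. The relations \<open>E\<^sup>d = 0\<close>, \<open>K\<^sup>d = 1\<close> and
  \<open>K E = q\<^sup>2 E K\<close> give \<open>E\<^sup>a K\<^sup>b \<cdot> E\<^sup>a' K\<^sup>b' = q\<^bsup>2ba'\<^esup> E\<^bsup>a+a'\<^esup> K\<^bsup>b+b'\<^esup>\<close>; the lemmas below recover the
  presentation from this product.\<close>

definition uq_basis :: "nat \<Rightarrow> (nat \<times> nat) set" where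
  "uq_basis d = {..<d} \<times> {..<d}"

definition uq_alg :: "complex \<Rightarrow> nat \<Rightarrow> (nat \<times> nat \<Rightarrow> complex) ring" where
  "uq_alg q d = based_alg (uq_basis d)
     (\<lambda>(a, b) (a', b').
        if a + a' < d then vscale (q ^ (2 * b * a')) (bvec (a + a', (b + b') mod d)) else vzero)
     (bvec (0, 0))"

definition uq_E :: "nat \<times> nat \<Rightarrow> complex" where
  "uq_E = bvec (1, 0)"

definition uq_K :: "nat \<times> nat \<Rightarrow> complex" where
  "uq_K = bvec (0, 1)"

lemma finite_uq_basis [simp]: "finite (uq_basis d)"
  by (simp add: uq_basis_def)

lemma uq_alg_mult_bvec:
  assumes "(a, b) \<in> uq_basis d" "(a', b') \<in> uq_basis d"
  shows "bvec (a, b) \<otimes>\<^bsub>uq_alg q d\<^esub> bvec (a', b') =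
    (if a + a' < d then vscale (q ^ (2 * b * a')) (bvec (a + a', (b + b') mod d)) else vzero)"
  using assms by (simp add: uq_alg_def linext_bvec)

lemma uq_alg_ring:
  assumes d: "d > 0" and q: "q ^ (2 * d) = 1"
  shows "ring (uq_alg q d)"
proof -
  have qmod: "q ^ (2 * (k mod d) * a) = q ^ (2 * k * a)" for k a
  proof -
    have "q ^ (2 * k * a) = q ^ (2 * d * (k div d * a) + 2 * (k mod d) * a)"
      by (rule arg_cong [of _ _ "\<lambda>t. q ^ t"])
        (metis (no_types) distrib_left distrib_right mult.assoc mult_div_mod_eq)
    then have "q ^ (2 * k * a) = (q ^ (2 * d)) ^ (k div d * a) * q ^ (2 * (k mod d) * a)"
      by (simp only: power_add power_mult [of q "2 * d"])
    then show ?thesis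
      by (simp only: q power_one mult_1)
  qed
  let ?m = "\<lambda>(a, b) (a', b').
    if a + a' < d then vscale (q ^ (2 * b * a')) (bvec (a + a', (b + b') mod d)) else vzero"
  show ?thesis
    unfolding uq_alg_def
  proof (rule based_alg_ring)
    fix p r s assume prs: "p \<in> uq_basis d" "r \<in> uq_basis d" "s \<in> uq_basis d"
    obtain a b a' b' a'' b'' where eq: "p = (a, b)" "r = (a', b')" "s = (a'', b'')"
      by (cases p, cases r, cases s)
    have in_B: "(x, y mod d) \<in> uq_basis d" if "x < d" for x y
      using that d by (simp add: uq_basis_def)
    show "linext (uq_basis d) (\<lambda>t. ?m t s) (?m p r) = linext (uq_basis d) (?m p) (?m r s)"
      using prs d
      by (simp add: eq linext_vscale linext_vzero linext_bvec in_B qmod)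
        (simp add: vscale_def vzero_def mod_add_left_eq mod_add_right_eq add.assoc distrib_left
          distrib_right power_add mult.assoc mult.left_commute mult.commute)
  qed (use d in \<open>auto simp: uq_basis_def linext_bvec\<close>)
qed

lemma uq_alg_E_power:
  assumes "d > 1"
  shows "uq_E [^]\<^bsub>uq_alg q d\<^esub> a = (if a < d then bvec (a, 0) else vzero)"
proof (induction a)
  case 0
  then show ?case using assms by (simp add: uq_alg_def)
next
  case (Suc a)
  have "vzero \<otimes>\<^bsub>uq_alg q d\<^esub> x = vzero" for x by (simp add: uq_alg_def linext_vzero)
  with Suc assms show ?case
    by (auto simp: uq_E_def uq_alg_mult_bvec uq_basis_def vscale_def)
qed

lemma uq_alg_K_power:
  assumes "d > 1"
  shows "uq_K [^]\<^bsub>uq_alg q d\<^esub> b = bvec (0, b mod d)"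
proof (induction b)
  case 0
  then show ?case using assms by (simp add: uq_alg_def)
next
  case (Suc b)
  with assms show ?case
    by (simp add: uq_K_def uq_alg_mult_bvec uq_basis_def vscale_def mod_Suc_eq)
qed

lemma uq_alg_relations:
  assumes "d > 1"
  shows "uq_E [^]\<^bsub>uq_alg q d\<^esub> d = \<zero>\<^bsub>uq_alg q d\<^esub>"
    and "uq_K [^]\<^bsub>uq_alg q d\<^esub> d = \<one>\<^bsub>uq_alg q d\<^esub>"
    and "uq_K \<otimes>\<^bsub>uq_alg q d\<^esub> uq_E = vscale (q\<^sup>2) (uq_E \<otimes>\<^bsub>uq_alg q d\<^esub> uq_K)"
proof -
  show "uq_E [^]\<^bsub>uq_alg q d\<^esub> d = \<zero>\<^bsub>uq_alg q d\<^esub>"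
    using assms by (simp add: uq_alg_E_power) (simp add: uq_alg_def)
  show "uq_K [^]\<^bsub>uq_alg q d\<^esub> d = \<one>\<^bsub>uq_alg q d\<^esub>"
    using assms by (simp add: uq_alg_K_power) (simp add: uq_alg_def)
  show "uq_K \<otimes>\<^bsub>uq_alg q d\<^esub> uq_E = vscale (q\<^sup>2) (uq_E \<otimes>\<^bsub>uq_alg q d\<^esub> uq_K)"
    using assms by (simp add: uq_E_def uq_K_def uq_alg_mult_bvec uq_basis_def vscale_def)
qed

lemma uq_alg_monomial:
  assumes "a < d" "b < d" "d > 1"
  shows "uq_E [^]\<^bsub>uq_alg q d\<^esub> a \<otimes>\<^bsub>uq_alg q d\<^esub> uq_K [^]\<^bsub>uq_alg q d\<^esub> b = bvec (a, b)"
  using assms by (simp add: uq_alg_E_power uq_alg_K_power uq_alg_mult_bvec uq_basis_def vscale_def)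

text \<open>The comultiplication is the algebra homomorphism into \<open>uq_tensor_alg\<close> with
  \<open>E \<mapsto> 1 \<otimes> E + E \<otimes> K\<close> and \<open>K \<mapsto> K \<otimes> K\<close>, so \<open>E\<^sup>a K\<^sup>b\<close> goes to \<open>\<Delta>(E)\<^sup>a \<Delta>(K)\<^sup>b\<close>. Counit and antipode
  play no role in tensor products of two modules.\<close>

definition uq_tensor_alg :: "complex \<Rightarrow> nat \<Rightarrow> ((nat \<times> nat) \<times> (nat \<times> nat) \<Rightarrow> complex) ring" where
  "uq_tensor_alg q d = tensor_alg (uq_basis d) (uq_alg q d) (uq_basis d) (uq_alg q d)"

definition uq_comult_E :: "complex \<Rightarrow> nat \<Rightarrow> (nat \<times> nat) \<times> (nat \<times> nat) \<Rightarrow> complex" where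
  "uq_comult_E q d = vadd (tens \<one>\<^bsub>uq_alg q d\<^esub> uq_E) (tens uq_E uq_K)"

definition uq_comult_K :: "(nat \<times> nat) \<times> (nat \<times> nat) \<Rightarrow> complex" where
  "uq_comult_K = tens uq_K uq_K"

definition uq_comult ::
    "complex \<Rightarrow> nat \<Rightarrow> (nat \<times> nat \<Rightarrow> complex) \<Rightarrow> (nat \<times> nat) \<times> (nat \<times> nat) \<Rightarrow> complex" where
  "uq_comult q d = linext (uq_basis d)
     (\<lambda>(a, b). (uq_comult_E q d [^]\<^bsub>uq_tensor_alg q d\<^esub> a)
        \<otimes>\<^bsub>uq_tensor_alg q d\<^esub> (uq_comult_K [^]\<^bsub>uq_tensor_alg q d\<^esub> b))"

lemma uq_tensor_alg_mult:
  assumes "p \<in> uq_basis d" "p' \<in> uq_basis d" "r \<in> uq_basis d" "r' \<in> uq_basis d"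
  shows "tens (bvec p) (bvec r) \<otimes>\<^bsub>uq_tensor_alg q d\<^esub> tens (bvec p') (bvec r') =
    tens (bvec p \<otimes>\<^bsub>uq_alg q d\<^esub> bvec p') (bvec r \<otimes>\<^bsub>uq_alg q d\<^esub> bvec r')"
proof -
  have "tens (bvec x) (bvec y) = bvec (x, y)" for x y :: "nat \<times> nat"
    by (auto simp: tens_def bvec_def fun_eq_iff)
  with assms show ?thesis
    by (simp add: uq_tensor_alg_def tensor_alg_def linext_bvec)
qed

lemma uq_comult_generators:
  assumes "d > 1"
  shows "uq_comult q d uq_E = uq_comult_E q d" and "uq_comult q d uq_K = uq_comult_K"
proof -
  let ?B = "uq_basis d \<times> uq_basis d"
  let ?T = "uq_tensor_alg q d"
  have tb: "tens (bvec x) (bvec y) = bvec (x, y)" for x y :: "nat \<times> nat"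
    by (auto simp: tens_def bvec_def fun_eq_iff)
  have one: "\<one>\<^bsub>?T\<^esub> = bvec ((0, 0), (0, 0))"
    by (simp add: uq_tensor_alg_def tensor_alg_def uq_alg_def tb)
  have mult: "x \<otimes>\<^bsub>?T\<^esub> y = linext ?B (\<lambda>p. linext ?B ((\<lambda>(p, r) (p', r').
      tens (bvec p \<otimes>\<^bsub>uq_alg q d\<^esub> bvec p') (bvec r \<otimes>\<^bsub>uq_alg q d\<^esub> bvec r')) p) y) x" for x y
    by (simp add: uq_tensor_alg_def tensor_alg_def)
  have in0: "(0, 0) \<in> uq_basis d"
    using assms by (simp add: uq_basis_def)
  have u0: "bvec (0, 0) \<otimes>\<^bsub>uq_alg q d\<^esub> bvec p = bvec p" "bvec p \<otimes>\<^bsub>uq_alg q d\<^esub> bvec (0, 0) = bvec p"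
    if "p \<in> uq_basis d" for p
    using that assms by (cases p; auto simp: uq_alg_mult_bvec in0 vscale_def uq_basis_def)+
  have l: "\<one>\<^bsub>?T\<^esub> \<otimes>\<^bsub>?T\<^esub> x = x" if "x \<in> cspace ?B" for x
  proof -
    have "\<one>\<^bsub>?T\<^esub> \<otimes>\<^bsub>?T\<^esub> x = linext ?B bvec x"
      unfolding mult one by (auto simp: linext_bvec in0 u0 tb intro!: linext_cong)
    with that show ?thesis by (simp add: linext_id)
  qed
  have r: "x \<otimes>\<^bsub>?T\<^esub> \<one>\<^bsub>?T\<^esub> = x" if "x \<in> cspace ?B" for x
  proof -
    have "x \<otimes>\<^bsub>?T\<^esub> \<one>\<^bsub>?T\<^esub> = linext ?B bvec x"
      unfolding mult one by (auto simp: linext_bvec in0 u0 tb intro!: linext_cong)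
    with that show ?thesis by (simp add: linext_id)
  qed
  have E: "uq_comult_E q d \<in> cspace ?B"
    using assms by (simp add: uq_comult_E_def uq_alg_def uq_E_def uq_K_def tb uq_basis_def)
  have K: "uq_comult_K \<in> cspace ?B"
    using assms by (simp add: uq_comult_K_def uq_K_def tb uq_basis_def)
  have I: "\<one>\<^bsub>?T\<^esub> \<in> cspace ?B" by (simp add: one in0)
  show "uq_comult q d uq_E = uq_comult_E q d"
    using assms by (simp add: uq_comult_def uq_E_def uq_basis_def linext_bvec l r [unfolded uq_basis_def] E
        E [unfolded uq_basis_def] l [unfolded uq_basis_def])
  show "uq_comult q d uq_K = uq_comult_K"
    using assms by (simp add: uq_comult_def uq_K_def uq_basis_def linext_bvec K [unfolded uq_basis_def]
        l [unfolded uq_basis_def] I [unfolded uq_basis_def])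
qed

abbreviation uq_tensor ::
    "complex \<Rightarrow> nat \<Rightarrow> (nat \<times> nat, 'a) fdmod \<Rightarrow> (nat \<times> nat, 'c) fdmod \<Rightarrow> (nat \<times> nat, 'a \<times> 'c) fdmod"
  where
  "uq_tensor q d \<equiv> tensor_module (uq_basis d) (uq_comult q d)"

section \<open>The indecomposable modules\<close>

definition indec_E :: "nat \<Rightarrow> (nat \<Rightarrow> complex) \<Rightarrow> nat \<Rightarrow> complex" where
  "indec_E u = linext {0..u} (\<lambda>j. if j < u then bvec (j + 1) else vzero)"

definition indec_K :: "complex \<Rightarrow> int \<Rightarrow> nat \<Rightarrow> (nat \<Rightarrow> complex) \<Rightarrow> nat \<Rightarrow> complex" where
  "indec_K q i u = linext {0..u} (\<lambda>j. vscale (q powi (2 * (i + int j))) (bvec j))"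

text \<open>The index in \<open>\<int>/d\<int>\<close> is given by an integer representative \<open>i\<close>; see \<open>indec_cong\<close> below.\<close>

definition indec :: "complex \<Rightarrow> nat \<Rightarrow> int \<Rightarrow> nat \<Rightarrow> (nat \<times> nat, nat) fdmod" where
  "indec q d i u =
     \<lparr>idx = {0..u},
      act = (\<lambda>h x. linext (uq_basis d) (\<lambda>(a, b). (indec_E u ^^ a) ((indec_K q i u ^^ b) x)) h)\<rparr>"

lemma indec_act_K:
  assumes "d > 1" "l \<le> u"
  shows "act (indec q d i u) uq_K (bvec l) = vscale (q powi (2 * (i + int l))) (bvec l)"
  using assms by (simp add: indec_def uq_K_def uq_basis_def linext_bvec indec_K_def)

lemma indec_act_E:
  assumes "d > 1" "l \<le> u"
  shows "act (indec q d i u) uq_E (bvec l) = (if l < u then bvec (l + 1) else vzero)"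
  using assms by (simp add: indec_def uq_E_def uq_basis_def linext_bvec indec_E_def)

lemma indec_cong:
  assumes q: "q ^ (2 * d) = 1" and d: "d > 0" and ii': "i mod int d = i' mod int d"
  shows "indec q d i u = indec q d i' u"
proof -
  have "q \<noteq> 0" using q d by (auto simp: power_0_left)
  have "q powi (2 * (i + k)) = q powi (2 * (i' + k))" for k
  proof -
    obtain t where t: "i = i' + int d * t"
      using ii' by (metis mod_eqE add.commute diff_add_cancel mult.commute add_diff_cancel_left' mod_eq_dvd_iff dvdE)
    have "q powi (2 * (i + k)) = q powi (2 * (i' + k) + int (2 * d) * t)"
      by (simp add: t algebra_simps)
    also have "\<dots> = q powi (2 * (i' + k)) * (q powi int (2 * d)) powi t"
      using \<open>q \<noteq> 0\<close> by (simp only: power_int_add power_int_mult [of q "int (2 * d)"] simp_thms)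
    also have "q powi int (2 * d) = 1" using q by (simp only: power_int_of_nat)
    finally show ?thesis by simp
  qed
  then have "indec_K q i u = indec_K q i' u" by (simp add: indec_K_def)
  then show ?thesis by (simp add: indec_def)
qed

definition proj_indec :: "complex \<Rightarrow> nat \<Rightarrow> int \<Rightarrow> (nat \<times> nat, nat) fdmod" where
  "proj_indec q d i = indec q d i (d - 1)"

end

theory Submission
  imports Defs "HOL-Library.Function_Algebras"
begin

text \<open>The tensor product is graded: \<open>e\<^sup>a \<otimes> e\<^sup>b\<close> has degree \<open>a + b\<close>, \<open>K\<close> acts on degree \<open>s\<close> as the scalar
  \<open>q\<^bsup>2(i+j+s)\<^esup>\<close>, and \<open>E\<close> raises the degree by one. A copy of \<open>M\<^sub>m\<^sup>r\<close> is a string \<open>w, E w, \<dots>, E\<^sup>r w\<close> with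
  \<open>E\<^bsup>r+1\<^esup> w = 0\<close>, so the claim is that the tensor product has a basis made of strings, one starting
  in each degree \<open>l \<le> min u v\<close>. Nonzero vectors \<open>E\<^sup>r w\<close> at the ends of strings, in pairwise different degrees,
  are linearly independent; strings with independent ends are independent; and independent
  strings whose lengths add up to the dimension form a basis (\<open>string_decomposition\<close>). It
  remains to find, for each \<open>l\<close>, one vector of degree \<open>l\<close> whose string has the right length.

  Let \<open>p = q\<^sup>2\<close>, which has order \<open>d\<close>. There are two kinds of strings.

  If \<open>l + (d - 1) \<le> u + v\<close>, the string should have the maximal length \<open>d\<close>. As \<open>1 \<otimes> E\<close> and \<open>E \<otimes> K\<close>
  \<open>p\<close>-commute, the powers of \<open>E\<close> are given by the \<open>p\<close>-binomial theorem (\<open>raise_pow_bvec\<close>). This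
  yields \<open>E\<^sup>d = 0\<close>, and it yields \<open>E\<^bsup>d-1\<^esup> (e\<^sup>l \<otimes> e\<^sup>0) \<noteq> 0\<close>, because the coefficients \<open>[d-1 choose m]\<close> do
  not vanish and at least one of the basis vectors involved lies in the \<open>u \<times> v\<close> grid.

  Otherwise the string should end in degree \<open>u + v - l\<close>, the mirror image of \<open>l\<close>. Here the
  argument is the one for \<open>sl\<^sub>2\<close>: there is an operator \<open>lower\<close> of degree \<open>-1\<close> whose commutator with \<open>E\<close>
  is a scalar on each degree (\<open>lower_raise\<close>). It has a nonzero kernel vector \<open>w\<close> in degree \<open>l\<close>, and
  \<open>lower (E\<^bsup>k+1\<^esup> w)\<close> is an explicit multiple of \<open>E\<^sup>k w\<close> (\<open>lower_raise_pow\<close>). The multiple is nonzero as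
  long as \<open>k < u + v - 2l\<close>, so \<open>E\<^bsup>u+v-2l\<^esup> w \<noteq> 0\<close>; it vanishes for \<open>k = u + v - 2l\<close>, and \<open>lower\<close> is
  injective on the degree \<open>u + v - l + 1\<close> reached there, so \<open>E\<^bsup>u+v-2l+1\<^esup> w = 0\<close>.

  The ends of the strings of the first kind lie in the degrees \<open>l + d - 1 \<ge> d - 1\<close>, those of the
  second kind in the degrees \<open>u + v - l < d - 1\<close>, so they are pairwise different.\<close>

section \<open>Linear algebra\<close>

lemma vscale_0: "vscale 0 x = vzero"
  by (simp add: vscale_def vzero_def)

lemma sum_fun_apply: "(\<Sum>a\<in>A. f a) b = (\<Sum>a\<in>A. f a b)" for f :: "'a \<Rightarrow> 'b \<Rightarrow> complex"
  by (induction A rule: infinite_finite_induct) auto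

lemma linext_eq_sum: "linext A f x = (\<Sum>a\<in>A. vscale (x a) (f a))"
  by (simp add: linext_def vscale_def sum_fun_apply fun_eq_iff)

lemma vzero_eq_0: "vzero = 0"
  by (simp add: vzero_def fun_eq_iff)

lemma linext_restrict: "linext A f (\<lambda>a. if a \<in> A then x a else 0) = linext A f x"
  by (simp add: linext_def)

text \<open>A linear map between spaces of the same finite dimension that is injective is surjective; the
  images of the basis vectors are an independent family of full size.\<close>

lemma linext_bij:
  fixes f :: "'a \<Rightarrow> 'b \<Rightarrow> complex"
  assumes fin: "finite A" "finite B" and card: "card A = card B"
    and f: "\<And>a. a \<in> A \<Longrightarrow> f a \<in> cspace B"
    and inj: "\<And>x. x \<in> cspace A \<Longrightarrow> linext A f x = vzero \<Longrightarrow> x = vzero"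
  shows "bij_betw (linext A f) (cspace A) (cspace B)"
proof -
  have inj_lin: "inj_on (linext A f) (cspace A)"
  proof (rule inj_onI)
    fix x y assume xy: "x \<in> cspace A" "y \<in> cspace A" "linext A f x = linext A f y"
    have "linext A f (vadd x (vscale (- 1) y)) = vzero"
      by (simp add: linext_vadd linext_vscale xy(3)) (simp add: vadd_def vscale_def vzero_def)
    then have "vadd x (vscale (- 1) y) = vzero"
      using xy by (intro inj) auto
    then show "x = y" by (simp add: vadd_def vscale_def vzero_def fun_eq_iff)
  qed
  have inj_f: "inj_on f A"
  proof (rule inj_onI)
    fix a b assume ab: "a \<in> A" "b \<in> A" "f a = f b"
    then have "bvec a = (bvec b :: 'a \<Rightarrow> complex)"
      using fin by (intro inj_onD [OF inj_lin]) (auto simp: linext_bvec)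
    from fun_cong [OF this, of a] show "a = b" by (simp add: bvec_def split: if_splits)
  qed
  interpret fun_space: vector_space "vscale :: complex \<Rightarrow> ('b \<Rightarrow> complex) \<Rightarrow> 'b \<Rightarrow> complex"
    by unfold_locales (auto simp: vscale_def fun_eq_iff algebra_simps)
  have reindex: "(\<Sum>y\<in>f ` A. vscale (g y) y) = linext A f (\<lambda>a. if a \<in> A then g (f a) else 0)" for g
    unfolding linext_restrict by (simp add: linext_eq_sum sum.reindex [OF inj_f])
  have indep: "fun_space.independent (f ` A)"
  proof (rule fun_space.independent_if_scalars_zero)
    fix g y assume "(\<Sum>y\<in>f ` A. vscale (g y) y) = 0" "y \<in> f ` A"
    then have "(\<lambda>a. if a \<in> A then g (f a) else 0) = vzero"
      by (intro inj) (auto simp: cspace_def reindex vzero_eq_0)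
    with \<open>y \<in> f ` A\<close> show "g y = 0" by (auto simp: vzero_def fun_eq_iff split: if_splits)
  qed (use fin in simp)
  have span: "cspace B \<subseteq> fun_space.span (bvec ` B)"
  proof
    fix y :: "'b \<Rightarrow> complex" assume "y \<in> cspace B"
    then have "y = (\<Sum>b\<in>B. vscale (y b) (bvec b))"
      using linext_id [OF fin(2)] by (simp add: linext_eq_sum)
    also have "\<dots> \<in> fun_space.span (bvec ` B)"
      by (intro fun_space.span_sum fun_space.span_scale fun_space.span_base) auto
    finally show "y \<in> fun_space.span (bvec ` B)" .
  qed
  have "cspace B \<subseteq> fun_space.span (f ` A)"
  proof
    fix y assume y: "y \<in> cspace B"
    show "y \<in> fun_space.span (f ` A)"
    proof (rule ccontr)
      assume n: "y \<notin> fun_space.span (f ` A)"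
      then have "fun_space.independent (insert y (f ` A))"
        using indep by (rule fun_space.independent_insertI)
      moreover have "insert y (f ` A) \<subseteq> fun_space.span (bvec ` B)"
        using y f span by blast
      ultimately have "card (insert y (f ` A)) \<le> card (bvec ` B :: ('b \<Rightarrow> complex) set)"
        using fun_space.independent_span_bound fin by blast
      moreover have "y \<notin> f ` A" using n fun_space.span_base by blast
      ultimately show False
        using card card_image_le [OF fin(2), of "bvec :: 'b \<Rightarrow> _"] fin card_image [OF inj_f] by simp
    qed
  qed
  also have "fun_space.span (f ` A) \<subseteq> linext A f ` cspace A"
  proof -
    have "linext A f (\<lambda>a. if a \<in> A then g (f a) else 0) \<in> linext A f ` cspace A" for g
      by (rule imageI) (simp add: cspace_def)
    then show ?thesis using fin by (auto simp: fun_space.span_finite reindex)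
  qed
  finally show ?thesis
    using inj_lin f by (auto simp: bij_betw_def intro: linext_cspace)
qed

lemma linext_swap:
  "linext A (\<lambda>a. linext B (F a) y) x = linext B (\<lambda>b. linext A (\<lambda>a. F a b) x) y"
  by (auto simp: linext_def sum_distrib_left mult.left_commute fun_eq_iff intro: sum.swap [THEN trans])

lemma linext_insert:
  "finite A \<Longrightarrow> a \<notin> A \<Longrightarrow> linext (insert a A) f x = vadd (vscale (x a) (f a)) (linext A f x)"
  by (simp add: linext_def vadd_def vscale_def)

lemma linext_empty: "linext {} f x = vzero"
  by (simp add: linext_def vzero_def)

text \<open>Linearity on all functions, not only on a coordinate space. Every operator used below is defined
  everywhere, and this saves the membership conditions.\<close>

definition linear_op :: "(('a \<Rightarrow> complex) \<Rightarrow> 'b \<Rightarrow> complex) \<Rightarrow> bool" where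
  "linear_op T \<longleftrightarrow> (\<forall>x y. T (vadd x y) = vadd (T x) (T y)) \<and> (\<forall>c x. T (vscale c x) = vscale c (T x))"

lemma linear_op_linext: "linear_op (linext A f)"
  by (simp add: linear_op_def linext_vadd linext_vscale)

lemma linear_op_vzero: "linear_op T \<Longrightarrow> T vzero = vzero"
proof -
  assume "linear_op T"
  then have "T (vscale 0 vzero) = vscale 0 (T vzero)" unfolding linear_op_def by blast
  then show ?thesis by (simp add: vscale_0)
qed

lemma linear_op_apply_linext:
  assumes "linear_op T" "finite A"
  shows "T (linext A f x) = linext A (\<lambda>a. T (f a)) x"
  using assms(2)
proof (induction A)
  case empty
  show ?case by (simp add: linext_empty linear_op_vzero [OF assms(1)])
next
  case (insert a A)
  then show ?case using assms(1) by (simp add: linext_insert linear_op_def)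
qed

lemma linear_op_funpow:
  fixes T :: "('a \<Rightarrow> complex) \<Rightarrow> 'a \<Rightarrow> complex"
  shows "linear_op T \<Longrightarrow> linear_op (T ^^ k)"
  by (induction k) (simp_all add: linear_op_def)

lemma linear_op_comp: "linear_op T \<Longrightarrow> linear_op S \<Longrightarrow> linear_op (\<lambda>x. T (S x))"
  by (simp add: linear_op_def)

section \<open>Modules and direct sums\<close>

lemma left_moduleD:
  assumes "is_left_module R V"
  shows "finite (idx V)"
    and "h \<in> carrier R \<Longrightarrow> x \<in> space V \<Longrightarrow> act V h x \<in> space V"
    and "h \<in> carrier R \<Longrightarrow> x \<in> space V \<Longrightarrow> y \<in> space V \<Longrightarrow>
      act V h (vadd x y) = vadd (act V h x) (act V h y)"
    and "h \<in> carrier R \<Longrightarrow> g \<in> carrier R \<Longrightarrow> x \<in> space V \<Longrightarrow>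
      act V (h \<oplus>\<^bsub>R\<^esub> g) x = vadd (act V h x) (act V g x)"
    and "h \<in> carrier R \<Longrightarrow> x \<in> space V \<Longrightarrow> act V h (vscale c x) = vscale c (act V h x)"
    and "h \<in> carrier R \<Longrightarrow> x \<in> space V \<Longrightarrow> act V (vscale c h) x = vscale c (act V h x)"
    and "x \<in> space V \<Longrightarrow> act V \<one>\<^bsub>R\<^esub> x = x"
    and "h \<in> carrier R \<Longrightarrow> g \<in> carrier R \<Longrightarrow> x \<in> space V \<Longrightarrow>
      act V (h \<otimes>\<^bsub>R\<^esub> g) x = act V h (act V g x)"
  using assms unfolding is_left_module_def by blast+

lemma space_simps [simp]:
  "vzero \<in> space V" "x \<in> space V \<Longrightarrow> y \<in> space V \<Longrightarrow> vadd x y \<in> space V"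
  "x \<in> space V \<Longrightarrow> vscale c x \<in> space V" "b \<in> idx V \<Longrightarrow> bvec b \<in> space V"
  by (simp_all add: space_def)

lemma linext_space: "(\<And>a. a \<in> A \<Longrightarrow> f a \<in> space V) \<Longrightarrow> linext A f x \<in> space V"
  by (simp add: space_def linext_cspace)

lemma act_vzero:
  assumes "is_left_module R V" "h \<in> carrier R"
  shows "act V h vzero = vzero"
proof -
  have "act V h (vscale 0 vzero) = vscale 0 (act V h vzero)"
    using assms by (simp add: left_moduleD)
  then show ?thesis by (simp add: vscale_0)
qed

lemma act_linext:
  assumes V: "is_left_module R V" and h: "h \<in> carrier R" and A: "finite A"
    and f: "\<And>a. a \<in> A \<Longrightarrow> f a \<in> space V"
  shows "act V h (linext A f x) = linext A (\<lambda>a. act V h (f a)) x"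
  using A f
proof (induction A)
  case empty
  show ?case by (simp add: linext_empty act_vzero [OF V h])
next
  case (insert a A)
  then show ?case by (simp add: linext_insert left_moduleD [OF V] h linext_space)
qed

text \<open>Restricted to algebras of the form \<open>based_alg\<close>, since the linear structure of the algebra must be
  that of the coordinates for \<open>linext\<close> to make sense in it.\<close>

lemma act_linext_alg:
  assumes V: "is_left_module (based_alg B m e) V" and A: "finite A"
    and g: "\<And>a. a \<in> A \<Longrightarrow> g a \<in> cspace B" and x: "x \<in> space V"
  shows "act V (linext A g h) x = linext A (\<lambda>a. act V (g a) x) h"
  using A g
proof (induction A)
  case empty
  have "act V (vscale 0 vzero) x = vscale 0 (act V vzero x)"
    using left_moduleD(6) [OF V, of vzero x 0] x by simp
  then show ?case by (simp add: linext_empty vscale_0)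
next
  case (insert a A)
  then have "linext (insert a A) g h = vscale (h a) (g a) \<oplus>\<^bsub>based_alg B m e\<^esub> linext A g h"
    by (simp add: linext_insert)
  then have "act V (linext (insert a A) g h) x
      = vadd (act V (vscale (h a) (g a)) x) (act V (linext A g h) x)"
    using insert x by (simp only:) (rule left_moduleD(4) [OF V]; simp add: linext_cspace)
  then show ?case using insert x
    by (simp add: linext_insert left_moduleD(6) [OF V])
qed

lemma isomorphic_modulesI:
  assumes "is_left_module R V" "is_left_module R W"
    and "bij_betw \<phi> (space V) (space W)"
    and "\<And>x y. x \<in> space V \<Longrightarrow> y \<in> space V \<Longrightarrow> \<phi> (vadd x y) = vadd (\<phi> x) (\<phi> y)"
    and "\<And>c x. x \<in> space V \<Longrightarrow> \<phi> (vscale c x) = vscale c (\<phi> x)"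
    and "\<And>h x. h \<in> carrier R \<Longrightarrow> x \<in> space V \<Longrightarrow> \<phi> (act V h x) = act W h (\<phi> x)"
  shows "isomorphic_modules R V W"
  using assms unfolding isomorphic_modules_def by blast

lemma isomorphic_modules_sym:
  assumes "isomorphic_modules R V W"
  shows "isomorphic_modules R W V"
proof -
  obtain \<phi> where mod: "is_left_module R V" "is_left_module R W" and bij: "bij_betw \<phi> (space V) (space W)"
    and add: "\<forall>x\<in>space V. \<forall>y\<in>space V. \<phi> (vadd x y) = vadd (\<phi> x) (\<phi> y)"
    and scale: "\<forall>c. \<forall>x\<in>space V. \<phi> (vscale c x) = vscale c (\<phi> x)"
    and act: "\<forall>h\<in>carrier R. \<forall>x\<in>space V. \<phi> (act V h x) = act W h (\<phi> x)"
    using assms unfolding isomorphic_modules_def by blast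
  define \<psi> where "\<psi> = the_inv_into (space V) \<phi>"
  have bij': "bij_betw \<psi> (space W) (space V)"
    unfolding \<psi>_def using bij by (rule bij_betw_the_inv_into)
  have \<psi>: "\<psi> y \<in> space V" "\<phi> (\<psi> y) = y" if "y \<in> space W" for y
    using that bij bij_betwE [OF bij'] f_the_inv_into_f_bij_betw [OF bij] by (auto simp: \<psi>_def)
  have \<psi>I: "\<psi> y = x" if "x \<in> space V" "\<phi> x = y" for x y
    using that bij by (auto simp: \<psi>_def bij_betw_def the_inv_into_f_f)
  show ?thesis
  proof (rule isomorphic_modulesI [OF mod(2,1) bij'])
    fix h y assume "h \<in> carrier R" "y \<in> space W"
    then show "\<psi> (act W h y) = act V h (\<psi> y)"
      using act \<psi> left_moduleD(2) [OF mod(1)] by (intro \<psi>I) auto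
  qed (use add scale \<psi> in \<open>auto intro!: \<psi>I\<close>)
qed

lemma isomorphic_modules_trans:
  assumes "isomorphic_modules R U V" "isomorphic_modules R V W"
  shows "isomorphic_modules R U W"
proof -
  obtain \<phi> where mod: "is_left_module R U" and bij: "bij_betw \<phi> (space U) (space V)"
    and \<phi>: "\<forall>x\<in>space U. \<forall>y\<in>space U. \<phi> (vadd x y) = vadd (\<phi> x) (\<phi> y)"
     "\<forall>c. \<forall>x\<in>space U. \<phi> (vscale c x) = vscale c (\<phi> x)"
     "\<forall>h\<in>carrier R. \<forall>x\<in>space U. \<phi> (act U h x) = act V h (\<phi> x)"
    using assms(1) unfolding isomorphic_modules_def by blast
  obtain \<psi> where mod': "is_left_module R W" and bij': "bij_betw \<psi> (space V) (space W)"
    and \<psi>: "\<forall>x\<in>space V. \<forall>y\<in>space V. \<psi> (vadd x y) = vadd (\<psi> x) (\<psi> y)"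
     "\<forall>c. \<forall>x\<in>space V. \<psi> (vscale c x) = vscale c (\<psi> x)"
     "\<forall>h\<in>carrier R. \<forall>x\<in>space V. \<psi> (act V h x) = act W h (\<psi> x)"
    using assms(2) unfolding isomorphic_modules_def by blast
  have "\<phi> x \<in> space V" if "x \<in> space U" for x using that bij by (auto simp: bij_betw_def)
  then show ?thesis
    using \<phi> \<psi> by (intro isomorphic_modulesI [OF mod mod' bij_betw_trans [OF bij bij']]) auto
qed

lemma direct_sum_module:
  assumes I: "finite I" and V: "\<And>l. l \<in> I \<Longrightarrow> is_left_module R (V l)"
  shows "is_left_module R (direct_sum I V)"
proof -
  \<comment> \<open>Two families agree if all their slices at a summand \<open>l\<close> agree, so each module axiom reduces
    to the same axiom in \<open>V l\<close>.\<close>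
  have slice: "(\<lambda>b. x (l, b)) \<in> space (V l)" if "x \<in> space (direct_sum I V)" "l \<in> I" for x l
    using that by (auto simp: space_def cspace_def direct_sum_def)
  have fin: "finite (idx (direct_sum I V))"
    using I left_moduleD(1) [OF V] by (auto simp: direct_sum_def)
  have sl: "(\<lambda>b. vadd x y (l, b)) = vadd (\<lambda>b. x (l, b)) (\<lambda>b. y (l, b))"
    "(\<lambda>b. vscale c x (l, b)) = vscale c (\<lambda>b. x (l, b))" for x y :: "_ \<times> _ \<Rightarrow> complex" and l c
    by (simp_all add: vadd_def vscale_def)
  have eq: "f = g" if "\<And>l. (\<lambda>b. f (l, b)) = (\<lambda>b. g (l, b))" for f g :: "_ \<times> _ \<Rightarrow> complex"
    using that by (auto simp: fun_eq_iff)
  have A: "(\<lambda>b. act (direct_sum I V) h x (l, b)) =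
      (if l \<in> I then act (V l) h (\<lambda>b. x (l, b)) else vzero)" for h x l
    by (simp add: direct_sum_def vzero_def)
  have sp: "x \<in> space (direct_sum I V) \<longleftrightarrow>
      (\<forall>l. if l \<in> I then (\<lambda>b. x (l, b)) \<in> space (V l) else (\<lambda>b. x (l, b)) = vzero)" for x
    by (auto simp: space_def cspace_def direct_sum_def vzero_def fun_eq_iff split: if_splits)
  have zz: "vadd vzero vzero = vzero" "vscale c vzero = vzero" for c
    by (simp_all add: vadd_def vscale_def vzero_def)
  have z: "(\<lambda>b. x (l, b)) = vzero" if "x \<in> space (direct_sum I V)" "l \<notin> I" for x l
    using that(1) [unfolded sp, rule_format, of l] that(2) by simp
  show ?thesis
    unfolding is_left_module_def
    using left_moduleD(2-) [OF V] fin
    by (intro conjI ballI allI eq) (auto simp: A sp sl slice zz z)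
qed

lemma direct_sum2_module:
  fixes V :: "('b, 'a) fdmod" and W :: "('b, 'c) fdmod"
  assumes V: "is_left_module R V" and W: "is_left_module R W"
  shows "is_left_module R (direct_sum2 V W)"
proof -
  have sl: "(\<lambda>b. vadd x y (Inl b)) = vadd (\<lambda>b. x (Inl b)) (\<lambda>b. y (Inl b))"
    "(\<lambda>b. vscale c x (Inl b)) = vscale c (\<lambda>b. x (Inl b))"
    "(\<lambda>b. vadd x y (Inr b)) = vadd (\<lambda>b. x (Inr b)) (\<lambda>b. y (Inr b))"
    "(\<lambda>b. vscale c x (Inr b)) = vscale c (\<lambda>b. x (Inr b))" for x y :: "'a + 'c \<Rightarrow> complex" and c
    by (simp_all add: vadd_def vscale_def)
  have eq: "f = g" if "(\<lambda>b. f (Inl b)) = (\<lambda>b. g (Inl b))" "(\<lambda>b. f (Inr b)) = (\<lambda>b. g (Inr b))"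
    for f g :: "'a + 'c \<Rightarrow> complex"
    using that by (simp add: fun_eq_iff split_sum_all)
  have A: "(\<lambda>b. act (direct_sum2 V W) h x (Inl b)) = act V h (\<lambda>b. x (Inl b))"
    "(\<lambda>b. act (direct_sum2 V W) h x (Inr b)) = act W h (\<lambda>b. x (Inr b))" for h x
    by (simp_all add: direct_sum2_def)
  have sp: "x \<in> space (direct_sum2 V W) \<longleftrightarrow>
      (\<lambda>b. x (Inl b)) \<in> space V \<and> (\<lambda>b. x (Inr b)) \<in> space W" for x
    by (auto simp: space_def cspace_def direct_sum2_def split_sum_all Plus_def)
  have fin: "finite (idx (direct_sum2 V W))"
    using left_moduleD(1) [OF V] left_moduleD(1) [OF W] by (simp add: direct_sum2_def)
  show ?thesis
    unfolding is_left_module_def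
    using left_moduleD(2-) [OF V] left_moduleD(2-) [OF W] fin
    by (intro conjI ballI allI eq) (auto simp: A sp sl)
qed

text \<open>The two-part sum in the final statement comes from splitting one sum over all strings.\<close>

lemma direct_sum_Un:
  fixes V :: "'i \<Rightarrow> ('b, 'a) fdmod"
  assumes fin: "finite I" "finite J" and dis: "I \<inter> J = {}"
    and V: "\<And>l. l \<in> I \<union> J \<Longrightarrow> is_left_module R (V l)"
  shows "isomorphic_modules R (direct_sum (I \<union> J) V) (direct_sum2 (direct_sum I V) (direct_sum J V))"
proof -
  define \<phi> :: "('i \<times> 'a \<Rightarrow> complex) \<Rightarrow> ('i \<times> 'a) + ('i \<times> 'a) \<Rightarrow> complex"
    where "\<phi> = (\<lambda>x. case_sum (\<lambda>(l, a). if l \<in> I then x (l, a) else 0)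
      (\<lambda>(l, a). if l \<in> J then x (l, a) else 0))"
  define \<psi> :: "(('i \<times> 'a) + ('i \<times> 'a) \<Rightarrow> complex) \<Rightarrow> 'i \<times> 'a \<Rightarrow> complex"
    where "\<psi> = (\<lambda>y (l, a). if l \<in> I then y (Inl (l, a)) else if l \<in> J then y (Inr (l, a)) else 0 :: complex)"
  have mem: "Inl s \<in> A <+> B \<longleftrightarrow> s \<in> A" "Inr s \<in> A <+> B \<longleftrightarrow> s \<in> B"
    for s and A B :: "('i \<times> 'a) set"
    by auto
  show ?thesis
  proof (rule isomorphic_modulesI)
    show "is_left_module R (direct_sum (I \<union> J) V)"
      using fin V by (intro direct_sum_module) auto
    show "is_left_module R (direct_sum2 (direct_sum I V) (direct_sum J V))"
      using fin V by (intro direct_sum_module direct_sum2_module) auto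
    show "bij_betw \<phi> (space (direct_sum (I \<union> J) V)) (space (direct_sum2 (direct_sum I V) (direct_sum J V)))"
    proof (rule bij_betw_byWitness [where f' = \<psi>])
      show "\<forall>x\<in>space (direct_sum (I \<union> J) V). \<psi> (\<phi> x) = x"
        by (auto simp: \<phi>_def \<psi>_def space_def cspace_def direct_sum_def fun_eq_iff)
      show "\<forall>y\<in>space (direct_sum2 (direct_sum I V) (direct_sum J V)). \<phi> (\<psi> y) = y"
        using dis by (auto simp: \<phi>_def \<psi>_def space_def cspace_def direct_sum_def direct_sum2_def
          fun_eq_iff split_sum_all mem)
      show "\<phi> ` space (direct_sum (I \<union> J) V) \<subseteq> space (direct_sum2 (direct_sum I V) (direct_sum J V))"
        by (auto simp: \<phi>_def space_def cspace_def direct_sum_def direct_sum2_def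
          split_sum_all mem)
      show "\<psi> ` space (direct_sum2 (direct_sum I V) (direct_sum J V)) \<subseteq> space (direct_sum (I \<union> J) V)"
        by (auto simp: \<psi>_def space_def cspace_def direct_sum_def direct_sum2_def
          split_sum_all mem)
    qed
    show "\<phi> (act (direct_sum (I \<union> J) V) h x) = act (direct_sum2 (direct_sum I V) (direct_sum J V)) h (\<phi> x)"
      for h x
      by (auto simp: \<phi>_def direct_sum_def direct_sum2_def fun_eq_iff split: sum.splits)
  qed (auto simp: \<phi>_def vadd_def vscale_def fun_eq_iff split: sum.splits)
qed

section \<open>Modules over the algebra of E and K\<close>

lemma act_funpow_alg:
  assumes V: "is_left_module (uq_alg q d) V" and h: "h \<in> cspace (uq_basis d)"
    and c: "\<And>n::nat. h [^]\<^bsub>uq_alg q d\<^esub> n \<in> cspace (uq_basis d)" and x: "x \<in> space V"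
  shows "act V (h [^]\<^bsub>uq_alg q d\<^esub> (n::nat)) x = (act V h ^^ n) x"
  using x
proof (induction n arbitrary: x)
  case 0
  then show ?case using left_moduleD(7) [OF V] by simp
next
  case (Suc n)
  have car: "carrier (uq_alg q d) = cspace (uq_basis d)" by (simp add: uq_alg_def)
  have "act V (h [^]\<^bsub>uq_alg q d\<^esub> Suc n) x = act V (h [^]\<^bsub>uq_alg q d\<^esub> n) (act V h x)"
    using Suc.prems h c by (simp add: left_moduleD(8) [OF V] car)
  also have "\<dots> = (act V h ^^ n) (act V h x)"
    using Suc.prems h left_moduleD(2) [OF V] by (intro Suc.IH) (simp add: car)
  finally show ?case by (simp add: funpow_swap1)
qed

lemma uq_carrier: "carrier (uq_alg q d) = cspace (uq_basis d)"
  by (simp add: uq_alg_def)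

lemma uq_gen_carrier:
  assumes "d > 1"
  shows "uq_E \<in> cspace (uq_basis d)" "uq_K \<in> cspace (uq_basis d)"
  using assms by (simp_all add: uq_E_def uq_K_def uq_basis_def)

text \<open>The action is determined by the two operators of the generators, as \<open>E\<^sup>a K\<^sup>b\<close> form a basis.\<close>

lemma act_generators:
  assumes V: "is_left_module (uq_alg q d) V" and d: "d > 1"
    and h: "h \<in> cspace (uq_basis d)" and x: "x \<in> space V"
  shows "act V h x = linext (uq_basis d) (\<lambda>(a, b). (act V uq_E ^^ a) ((act V uq_K ^^ b) x)) h"
proof -
  let ?R = "uq_alg q d"
  have E: "uq_E [^]\<^bsub>?R\<^esub> a \<in> cspace (uq_basis d)" for a :: nat
    using d by (auto simp: uq_alg_E_power uq_basis_def)
  have K: "uq_K [^]\<^bsub>?R\<^esub> b \<in> cspace (uq_basis d)" for b :: nat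
    using d by (simp add: uq_alg_K_power uq_basis_def)
  have Kx: "(act V uq_K ^^ b) x \<in> space V" for b
    using x left_moduleD(2) [OF V] uq_gen_carrier [OF d] by (induction b) (simp_all add: uq_carrier)
  have "act V (bvec (a, b)) x = (act V uq_E ^^ a) ((act V uq_K ^^ b) x)" if "(a, b) \<in> uq_basis d" for a b
  proof -
    have "bvec (a, b) = uq_E [^]\<^bsub>?R\<^esub> a \<otimes>\<^bsub>?R\<^esub> uq_K [^]\<^bsub>?R\<^esub> b"
      using that d by (simp add: uq_alg_monomial uq_basis_def)
    then have "act V (bvec (a, b)) x = act V (uq_E [^]\<^bsub>?R\<^esub> a) (act V (uq_K [^]\<^bsub>?R\<^esub> b) x)"
      using E K x by (simp only: left_moduleD(8) [OF V] uq_carrier)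
    then show ?thesis
      using E K Kx x uq_gen_carrier [OF d] by (simp add: act_funpow_alg [OF V])
  qed
  then have "linext (uq_basis d) (\<lambda>p. act V (bvec p) x) h =
      linext (uq_basis d) (\<lambda>(a, b). (act V uq_E ^^ a) ((act V uq_K ^^ b) x)) h"
    by (intro linext_cong) auto
  moreover have "act V (linext (uq_basis d) bvec h) x = linext (uq_basis d) (\<lambda>p. act V (bvec p) x) h"
    using V x unfolding uq_alg_def by (intro act_linext_alg) auto
  ultimately show ?thesis using h by (simp add: linext_id)
qed

text \<open>By \<open>act_generators\<close> a linear map that intertwines \<open>E\<close> and \<open>K\<close> intertwines the whole algebra.\<close>

lemma isomorphic_modules_generatorsI:
  assumes V: "is_left_module (uq_alg q d) V" and W: "is_left_module (uq_alg q d) W" and d: "d > 1"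
    and bij: "bij_betw \<phi> (space V) (space W)" and lin: "linear_op \<phi>"
    and E: "\<And>x. x \<in> space V \<Longrightarrow> \<phi> (act V uq_E x) = act W uq_E (\<phi> x)"
    and K: "\<And>x. x \<in> space V \<Longrightarrow> \<phi> (act V uq_K x) = act W uq_K (\<phi> x)"
  shows "isomorphic_modules (uq_alg q d) V W"
proof (rule isomorphic_modulesI [OF V W bij])
  fix h x assume h: "h \<in> carrier (uq_alg q d)" and x: "x \<in> space V"
  have sp: "act V uq_E y \<in> space V" "act V uq_K y \<in> space V" if "y \<in> space V" for y
    using that left_moduleD(2) [OF V] uq_gen_carrier [OF d] by (simp_all add: uq_carrier)
  have Ksp: "(act V uq_K ^^ b) y \<in> space V" if "y \<in> space V" for b y
    using that by (induction b) (simp_all add: sp)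
  have Esp: "(act V uq_E ^^ b) y \<in> space V" if "y \<in> space V" for b y
    using that by (induction b) (simp_all add: sp)
  have "\<phi> ((act V uq_E ^^ a) y) = (act W uq_E ^^ a) (\<phi> y)" if "y \<in> space V" for a y
    using that by (induction a) (simp_all add: E Esp)
  moreover have "\<phi> ((act V uq_K ^^ a) y) = (act W uq_K ^^ a) (\<phi> y)" if "y \<in> space V" for a y
    using that by (induction a) (simp_all add: K Ksp)
  ultimately have "\<phi> ((act V uq_E ^^ a) ((act V uq_K ^^ b) x)) =
      (act W uq_E ^^ a) ((act W uq_K ^^ b) (\<phi> x))" for a b
    using x Ksp by simp
  moreover have "\<phi> x \<in> space W" using bij x by (auto simp: bij_betw_def)
  ultimately show "\<phi> (act V h x) = act W h (\<phi> x)"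
    using h x unfolding uq_carrier
    by (simp add: act_generators [OF V d] act_generators [OF W d] linear_op_apply_linext [OF lin]
        split_def)
qed (use lin in \<open>auto simp: linear_op_def\<close>)

text \<open>Converse of \<open>act_generators\<close>: two operators satisfying the defining relations of the algebra make
  a module. The multiplication table gives \<open>E\<^sup>a K\<^sup>b E\<^sup>a' K\<^sup>b' = q\<^bsup>2ba'\<^esup> E\<^bsup>a+a'\<^esup> K\<^bsup>b+b'\<^esup>\<close>, and the
  operators satisfy the same equation.\<close>

lemma operators_module:
  assumes fin: "finite (idx V)" and d: "d > 1"
    and lin: "linear_op E" "linear_op K"
    and sp: "\<And>x. x \<in> space V \<Longrightarrow> E x \<in> space V" "\<And>x. x \<in> space V \<Longrightarrow> K x \<in> space V"
    and Ed: "\<And>x. x \<in> space V \<Longrightarrow> (E ^^ d) x = vzero"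
    and Kd: "\<And>x. x \<in> space V \<Longrightarrow> (K ^^ d) x = x"
    and KE: "\<And>x. x \<in> space V \<Longrightarrow> K (E x) = vscale (q\<^sup>2) (E (K x))"
    and act: "\<And>h x. x \<in> space V \<Longrightarrow>
      act V h x = linext (uq_basis d) (\<lambda>(a, b). (E ^^ a) ((K ^^ b) x)) h"
  shows "is_left_module (uq_alg q d) V"
proof -
  let ?B = "uq_basis d"
  \<comment> \<open>\<open>M (a, b)\<close> is the operator of the basis element \<open>E\<^sup>a K\<^sup>b\<close>.\<close>
  define M where "M = (\<lambda>(a, b) x. (E ^^ a) ((K ^^ b) x))"
  have act: "act V h x = linext ?B (\<lambda>t. M t x) h" if "x \<in> space V" for h x
    using act [OF that] by (simp add: M_def split_def)
  have Esp: "(E ^^ a) x \<in> space V" if "x \<in> space V" for a x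
    using that by (induction a) (simp_all add: sp)
  have Ksp: "(K ^^ a) x \<in> space V" if "x \<in> space V" for a x
    using that by (induction a) (simp_all add: sp)
  have Msp: "M t x \<in> space V" if "x \<in> space V" for t x
    using that by (cases t) (simp add: M_def Esp Ksp)
  have Mlin: "linear_op (M t)" for t
    unfolding M_def by (cases t) (simp add: linear_op_comp linear_op_funpow lin)
  have E_ge: "(E ^^ n) x = vzero" if "d \<le> n" "x \<in> space V" for n x
  proof -
    have "(E ^^ n) x = (E ^^ (n - d)) ((E ^^ d) x)"
      using that(1) by (simp flip: funpow_add [unfolded o_def fun_eq_iff, rule_format])
    then show ?thesis using that by (simp add: Ed linear_op_vzero linear_op_funpow lin)
  qed
  have K_mod: "(K ^^ (n mod d)) x = (K ^^ n) x" if "x \<in> space V" for n x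
  proof -
    have "(K ^^ (d * k)) y = y" if "y \<in> space V" for k y
      using that by (induction k) (simp_all add: funpow_add Kd)
    then have "(K ^^ (n mod d + d * (n div d))) x = (K ^^ (n mod d)) x"
      using that unfolding funpow_add o_apply by simp
    then show ?thesis by simp
  qed
  have KE1: "(K ^^ b) (E x) = vscale (q ^ (2 * b)) (E ((K ^^ b) x))" if "x \<in> space V" for b x
  proof (induction b)
    case 0
    then show ?case by simp
  next
    case (Suc b)
    then show ?case
      using lin Ksp [OF that] by (simp add: linear_op_def KE)
        (simp add: vscale_def power2_eq_square mult_ac)
  qed
  have KEn: "(K ^^ b) ((E ^^ a) x) = vscale (q ^ (2 * b * a)) ((E ^^ a) ((K ^^ b) x))"
    if "x \<in> space V" for a b x
  proof (induction a)
    case 0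
    then show ?case by simp
  next
    case (Suc a)
    then show ?case
      using lin Esp [OF that] by (simp add: linear_op_def KE1)
        (simp add: vscale_def power_add mult_ac)
  qed
  let ?m = "\<lambda>(a, b) (a', b').
    if a + a' < d then vscale (q ^ (2 * b * a')) (bvec (a + a', (b + b') mod d)) else vzero"
  have MM: "linext ?B (\<lambda>t. M t x) (?m p r) = M p (M r x)"
    if x: "x \<in> space V" and "p \<in> ?B" "r \<in> ?B" for p r x
  proof -
    obtain a b a' b' where pr: "p = (a, b)" "r = (a', b')" by (cases p, cases r)
    have "M p (M r x) = vscale (q ^ (2 * b * a')) ((E ^^ (a + a')) ((K ^^ (b + b')) x))"
      using x linear_op_funpow [OF lin(1), of a]
      by (simp add: M_def pr KEn Ksp linear_op_def funpow_add)
    then show ?thesis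
      using x d pr that(2,3)
      by (auto simp: linext_vscale linext_vzero linext_bvec uq_basis_def M_def K_mod E_ge Ksp)
        (simp_all add: vscale_def vzero_def)
  qed
  have mult: "act V (h \<otimes>\<^bsub>uq_alg q d\<^esub> g) x = act V h (act V g x)" if x: "x \<in> space V" for h g x
  proof -
    have "act V (h \<otimes>\<^bsub>uq_alg q d\<^esub> g) x = linext ?B (\<lambda>p. linext ?B (\<lambda>r. linext ?B (\<lambda>t. M t x) (?m p r)) g) h"
      using x by (simp add: uq_alg_def act linext_linext)
    also have "\<dots> = linext ?B (\<lambda>p. linext ?B (\<lambda>r. M p (M r x)) g) h"
      using x by (intro linext_cong MM) auto
    also have "\<dots> = linext ?B (\<lambda>p. M p (linext ?B (\<lambda>r. M r x) g)) h"
      by (simp add: linear_op_apply_linext [OF Mlin])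
    also have "\<dots> = act V h (act V g x)"
      using x by (simp add: act linext_space Msp)
    finally show ?thesis .
  qed
  have one: "act V \<one>\<^bsub>uq_alg q d\<^esub> x = x" if "x \<in> space V" for x
    using that d by (simp add: act uq_alg_def linext_bvec uq_basis_def M_def)
  have add: "act V (h \<oplus>\<^bsub>uq_alg q d\<^esub> g) x = vadd (act V h x) (act V g x)" if "x \<in> space V" for h g x
    using that by (simp add: act uq_alg_def linext_vadd)
  have add2: "act V h (vadd x y) = vadd (act V h x) (act V h y)" if "x \<in> space V" "y \<in> space V" for h x y
    using that Mlin by (simp add: act linear_op_def linext_vadd_fun)
  have scale: "act V h (vscale c x) = vscale c (act V h x)"
    "act V (vscale c h) x = vscale c (act V h x)" if "x \<in> space V" for c h x
    using that Mlin by (simp_all add: act linear_op_def linext_vscale_fun linext_vscale)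
  have "act V h x \<in> space V" if "x \<in> space V" for h x
    using that by (simp add: act linext_space Msp)
  with fin mult one add add2 scale show ?thesis
    unfolding is_left_module_def by blast
qed

lemma indec_E_apply: "indec_E u x b = (if 0 < b \<and> b \<le> u then x (b - 1) else 0)"
proof -
  have "indec_E u x b = (\<Sum>j\<in>{0..u}. if j = b - 1 then (if 0 < b \<and> b \<le> u then x j else 0) else 0)"
    unfolding indec_E_def linext_def by (rule sum.cong) (auto simp: bvec_def vzero_def)
  then show ?thesis by auto
qed

lemma indec_K_apply: "indec_K q i u x b = (if b \<le> u then q powi (2 * (i + int b)) * x b else 0)"
proof -
  have "indec_K q i u x b = (\<Sum>j\<in>{0..u}. if j = b then q powi (2 * (i + int j)) * x j else 0)"
    unfolding indec_K_def linext_def by (rule sum.cong) (auto simp: bvec_def vscale_def)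
  then show ?thesis by auto
qed

lemma weight_Suc:
  fixes q :: complex
  assumes "q \<noteq> 0"
  shows "q powi (2 * (m + int (Suc k))) = q\<^sup>2 * q powi (2 * (m + int k))"
proof -
  have "2 * (m + int (Suc k)) = 2 + 2 * (m + int k)" by simp
  then have "q powi (2 * (m + int (Suc k))) = q powi (2 + 2 * (m + int k))"
    by (rule arg_cong)
  also have "\<dots> = q powi 2 * q powi (2 * (m + int k))"
    using assms by (intro power_int_add) simp
  finally show ?thesis by simp
qed

text \<open>Every eigenvalue of \<open>K\<close> is a \<open>d\<close>-th root of unity, whence \<open>K\<^sup>d = 1\<close>.\<close>

lemma weight_pow_ord:
  fixes q :: complex
  assumes "q ^ (2 * d) = 1"
  shows "(q powi (2 * t)) ^ d = 1"
proof -
  have "(q powi (2 * t)) ^ d = q powi (2 * t * int d)"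
    by (simp only: power_int_mult power_int_of_nat)
  also have "2 * t * int d = int (2 * d) * t" by simp
  also have "q powi \<dots> = (q ^ (2 * d)) powi t"
    by (simp only: power_int_mult power_int_of_nat)
  finally show ?thesis using assms by simp
qed

lemma indec_module:
  assumes d: "d > 1" and q: "q ^ (2 * d) = 1" and u: "u < d"
  shows "is_left_module (uq_alg q d) (indec q d i u)"
proof (rule operators_module [where E = "indec_E u" and K = "indec_K q i u"])
  have "q \<noteq> 0" using q d by (auto simp: power_0_left)
  show "finite (idx (indec q d i u))" by (simp add: indec_def)
  show "linear_op (indec_E u)" "linear_op (indec_K q i u)"
    by (simp_all add: indec_E_def indec_K_def linear_op_linext)
  show "act (indec q d i u) h x =
    linext (uq_basis d) (\<lambda>(a, b). (indec_E u ^^ a) ((indec_K q i u ^^ b) x)) h" for h x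
    by (simp add: indec_def)
  fix x assume "x \<in> space (indec q d i u)"
  then have x: "x b = 0" if "b > u" for b using that by (simp add: space_def indec_def cspace_def)
  show "indec_E u x \<in> space (indec q d i u)" "indec_K q i u x \<in> space (indec q d i u)"
    by (simp_all add: space_def indec_def cspace_def indec_E_apply indec_K_apply)
  have "(indec_E u ^^ k) x b = (if k \<le> b \<and> b \<le> u then x (b - k) else 0)" for k b
    using x by (induction k arbitrary: b) (auto simp: indec_E_apply)
  then show "(indec_E u ^^ d) x = vzero"
    using u by (auto simp: vzero_def fun_eq_iff)
  have "(indec_K q i u ^^ k) x b = (q powi (2 * (i + int b))) ^ k * x b" for k b
    using x by (induction k) (auto simp: indec_K_apply)
  moreover note weight_pow_ord [OF q]
  ultimately show "(indec_K q i u ^^ d) x = x"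
    by (intro ext) (simp only: mult_1)
  show "indec_K q i u (indec_E u x) = vscale (q\<^sup>2) (indec_E u (indec_K q i u x))"
  proof
    fix b
    have "q powi (2 * (i + int b)) = q\<^sup>2 * q powi (2 * (i + int (b - 1)))" if "0 < b"
      using that weight_Suc [OF \<open>q \<noteq> 0\<close>, of i "b - 1"] by simp
    then show "indec_K q i u (indec_E u x) b = vscale (q\<^sup>2) (indec_E u (indec_K q i u x)) b"
      by (auto simp: indec_K_apply indec_E_apply vscale_def)
  qed
qed (use d in simp)

lemma act_K_E_pow:
  assumes V: "is_left_module (uq_alg q d) V" and d: "d > 1" and q: "q \<noteq> 0"
    and w: "w \<in> space V" "act V uq_K w = vscale (q powi (2 * m)) w"
  shows "act V uq_K ((act V uq_E ^^ k) w) = vscale (q powi (2 * (m + int k))) ((act V uq_E ^^ k) w)"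
proof (induction k)
  case 0
  then show ?case using w by simp
next
  case (Suc k)
  let ?R = "uq_alg q d" and ?x = "(act V uq_E ^^ k) w"
  note c = uq_gen_carrier [OF d, folded uq_carrier [of q]]
  have x: "?x \<in> space V"
    using w left_moduleD(2) [OF V] c by (induction k) simp_all
  have EK: "uq_E \<otimes>\<^bsub>?R\<^esub> uq_K \<in> carrier ?R"
    using d by (simp add: uq_E_def uq_K_def uq_alg_mult_bvec uq_basis_def uq_carrier)
  have "act V uq_K (act V uq_E ?x) = act V (uq_K \<otimes>\<^bsub>?R\<^esub> uq_E) ?x"
    using x c by (simp add: left_moduleD(8) [OF V])
  also have "\<dots> = vscale (q\<^sup>2) (act V uq_E (act V uq_K ?x))"
    using x c EK by (simp add: uq_alg_relations(3) [OF d] left_moduleD(6,8) [OF V])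
  also have "\<dots> = vscale (q\<^sup>2 * q powi (2 * (m + int k))) (act V uq_E ?x)"
    using x c Suc by (simp add: left_moduleD(5) [OF V]) (simp add: vscale_def mult.assoc)
  also have "q\<^sup>2 * q powi (2 * (m + int k)) = q powi (2 * (m + int (Suc k)))"
    by (rule weight_Suc [OF q, symmetric])
  finally show ?case by simp
qed

text \<open>The strings \<open>w l, E (w l), \<dots>, E\<^bsup>r l\<^esup> (w l)\<close> are submodules isomorphic to indecomposable ones. They
  are jointly independent as soon as their last vectors are: in a vanishing combination, let
  \<open>\<rho>\<close> be the largest distance to the end of a string at which a nonzero coefficient occurs. Then
  \<open>E\<^bsup>\<rho>\<^esup>\<close> kills all terms closer to the end and moves those at distance \<open>\<rho>\<close> to the last vectors, so
  these coefficients vanish. Being as many as the dimension, the vectors form a basis.\<close>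

lemma string_decomposition:
  assumes V: "is_left_module (uq_alg q d) V" and d: "d > 1" and q: "q ^ (2 * d) = 1"
    and J: "finite J" and r: "\<And>l. l \<in> J \<Longrightarrow> r l < d"
    and w: "\<And>l. l \<in> J \<Longrightarrow> w l \<in> space V"
    and wK: "\<And>l. l \<in> J \<Longrightarrow> act V uq_K (w l) = vscale (q powi (2 * m l)) (w l)"
    and wE: "\<And>l. l \<in> J \<Longrightarrow> (act V uq_E ^^ Suc (r l)) (w l) = vzero"
    and ends: "\<And>c. linext J (\<lambda>l. (act V uq_E ^^ r l) (w l)) c = vzero \<Longrightarrow> \<forall>l\<in>J. c l = 0"
    and card: "(\<Sum>l\<in>J. r l + 1) = card (idx V)"
  shows "isomorphic_modules (uq_alg q d) V (direct_sum J (\<lambda>l. indec q d (m l) (r l)))"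
proof -
  let ?W = "direct_sum J (\<lambda>l. indec q d (m l) (r l))" and ?E = "act V uq_E"
  have q0: "q \<noteq> 0" using q d by (auto simp: power_0_left)
  note c = uq_gen_carrier [OF d, folded uq_carrier [of q]]
  have W: "is_left_module (uq_alg q d) ?W"
    using d q r J by (intro direct_sum_module indec_module) auto
  define S where "S = Sigma J (\<lambda>l. {0..r l})"
  have idxW: "idx ?W = S" by (simp add: S_def direct_sum_def indec_def)
  have S: "finite S" using J by (simp add: S_def)
  define f where "f = (\<lambda>(l, k). (?E ^^ k) (w l))"
  have Ew: "(?E ^^ k) (w l) \<in> space V" if "l \<in> J" for k l
    using w [OF that] left_moduleD(2) [OF V] c by (induction k) simp_all
  have f: "f s \<in> space V" if "s \<in> S" for s
    using that Ew by (auto simp: f_def S_def)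
  have E_lin: "?E (linext A g x) = linext A (\<lambda>a. ?E (g a)) x"
    if "finite A" "\<And>a. a \<in> A \<Longrightarrow> g a \<in> space V" for A :: "('b \<times> nat) set" and g x
    using that V c by (intro act_linext) auto
  have Epow_lin: "(?E ^^ k) (linext S f x) = linext S (\<lambda>s. (?E ^^ k) (f s)) x" for k x
  proof (induction k)
    case (Suc k)
    have "(?E ^^ k) (f s) \<in> space V" if "s \<in> S" for s
      using f [OF that] left_moduleD(2) [OF V] c by (induction k) simp_all
    with Suc show ?case by (simp add: E_lin S)
  qed simp
  have E0: "(?E ^^ k) (w l) = vzero" if "l \<in> J" "k > r l" for k l
  proof -
    have "(?E ^^ j) vzero = vzero" for j
      using act_vzero [OF V c(1)] by (induction j) simp_all
    moreover have "(?E ^^ k) (w l) = (?E ^^ (k - Suc (r l))) ((?E ^^ Suc (r l)) (w l))"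
    proof -
      have "k = (k - Suc (r l)) + Suc (r l)" using that by simp
      then show ?thesis by (metis funpow_add o_apply)
    qed
    ultimately show ?thesis using wE [OF that(1)] by simp
  qed
  have inj: "x = vzero" if x: "x \<in> cspace S" "linext S f x = vzero" for x
  proof (rule ccontr)
    assume "x \<noteq> vzero"
    then obtain t where "x t \<noteq> 0" by (auto simp: vzero_def fun_eq_iff)
    define T where "T = {s \<in> S. x s \<noteq> 0}"
    define h where "h = (\<lambda>(l, k). r l - k)"
    have "finite T" using S by (simp add: T_def)
    have "t \<in> T" using \<open>x t \<noteq> 0\<close> x(1) unfolding T_def cspace_def by blast
    \<comment> \<open>\<open>h\<close> is the distance to the end of the string.\<close>
    define \<rho> where "\<rho> = Max (h ` T)"
    have "\<rho> \<in> h ` T" unfolding \<rho>_def using \<open>finite T\<close> \<open>t \<in> T\<close> by (intro Max_in) auto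
    have le: "h s \<le> \<rho>" if "s \<in> T" for s
      unfolding \<rho>_def using \<open>finite T\<close> that by (intro Max_ge) auto
    define cc where "cc = (\<lambda>l. if \<rho> \<le> r l then x (l, r l - \<rho>) else 0)"
    have "vzero = (?E ^^ \<rho>) (linext S f x)"
      using x(2) act_vzero [OF V c(1)] by (induction \<rho>) simp_all
    also have "\<dots> = linext S (\<lambda>s. (?E ^^ \<rho>) (f s)) x" by (rule Epow_lin)
    also have "\<dots> = linext J (\<lambda>l. (?E ^^ r l) (w l)) cc"
    proof
      fix b
      have "linext S (\<lambda>s. (?E ^^ \<rho>) (f s)) x b
          = (\<Sum>l\<in>J. \<Sum>k\<in>{0..r l}. x (l, k) * (?E ^^ \<rho>) (f (l, k)) b)"
        unfolding linext_def S_def using J by (simp add: sum.Sigma case_prod_beta)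
      also have "\<dots> = (\<Sum>l\<in>J. cc l * (?E ^^ r l) (w l) b)"
      proof (rule sum.cong [OF refl])
        fix l assume l: "l \<in> J"
        have "x (l, k) * (?E ^^ \<rho>) (f (l, k)) b =
            (if k = r l - \<rho> then cc l * (?E ^^ r l) (w l) b else 0)" if k: "k \<in> {0..r l}" for k
        proof -
          have eq: "(?E ^^ \<rho>) (f (l, k)) = (?E ^^ (\<rho> + k)) (w l)"
            by (simp add: f_def funpow_add)
          consider "\<rho> + k > r l" | "\<rho> + k = r l" | "\<rho> + k < r l" by linarith
          then show ?thesis
          proof cases
            case 1
            then show ?thesis using E0 [OF l 1] k unfolding eq
              by (auto simp: vzero_def cc_def)
          next
            case 2
            then show ?thesis unfolding eq by (auto simp: cc_def)
          next
            case 3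
            then have "(l, k) \<notin> T" using le [of "(l, k)"] by (auto simp: h_def)
            then have "x (l, k) = 0" using l k by (auto simp: T_def S_def)
            with 3 show ?thesis by auto
          qed
        qed
        then have "(\<Sum>k\<in>{0..r l}. x (l, k) * (?E ^^ \<rho>) (f (l, k)) b) =
            (\<Sum>k\<in>{0..r l}. if k = r l - \<rho> then cc l * (?E ^^ r l) (w l) b else 0)"
          by (intro sum.cong refl)
        then show "(\<Sum>k\<in>{0..r l}. x (l, k) * (?E ^^ \<rho>) (f (l, k)) b) = cc l * (?E ^^ r l) (w l) b"
          by simp
      qed
      finally show "linext S (\<lambda>s. (?E ^^ \<rho>) (f s)) x b = linext J (\<lambda>l. (?E ^^ r l) (w l)) cc b"
        by (simp add: linext_def)
    qed
    finally have "\<forall>l\<in>J. cc l = 0" using ends by metis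
    moreover from \<open>\<rho> \<in> h ` T\<close> obtain l k where "(l, k) \<in> T" "\<rho> = r l - k" by (auto simp: h_def)
    ultimately show False by (auto simp: T_def S_def cc_def)
  qed
  have "card S = card (idx V)"
    using J card by (simp add: S_def)
  then have bij: "bij_betw (linext S f) (space ?W) (space V)"
    unfolding space_def idxW using f S left_moduleD(1) [OF V] inj
    by (intro linext_bij) (auto simp: space_def)
  have actW: "act ?W h (bvec (l, k)) = linext {0..r l} (\<lambda>b. bvec (l, b)) (act (indec q d (m l) (r l)) h (bvec k))"
    if "(l, k) \<in> S" "h \<in> carrier (uq_alg q d)" for h l k
  proof -
    have l: "l \<in> J" "k \<le> r l" using that by (auto simp: S_def)
    have mod: "is_left_module (uq_alg q d) (indec q d (m l') (r l'))" if "l' \<in> J" for l'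
      using d q r [OF that] by (rule indec_module)
    have "(\<lambda>b. bvec (l, k) (l', b)) = (if l' = l then bvec k else vzero)" for l'
      by (auto simp: bvec_def vzero_def)
    then have 1: "act ?W h (bvec (l, k)) = (\<lambda>(l', a). if l' = l then act (indec q d (m l) (r l)) h (bvec k) a else 0)"
      using l act_vzero [OF mod that(2)] by (auto simp: direct_sum_def vzero_def fun_eq_iff)
    have sp: "act (indec q d (m l) (r l)) h (bvec k) \<in> cspace {0..r l}"
      using left_moduleD(2) [OF mod [OF l(1)] that(2), of "bvec k"] l
      by (simp add: space_def indec_def)
    show ?thesis
    proof (rule ext, clarify)
      fix l' a
      show "act ?W h (bvec (l, k)) (l', a) =
        linext {0..r l} (\<lambda>b. bvec (l, b)) (act (indec q d (m l) (r l)) h (bvec k)) (l', a)"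
        using sp unfolding 1 by (auto simp: linext_def bvec_def cspace_def if_distrib cong: if_cong)
    qed
  qed
  have f_act: "linext S f (act ?W h (bvec s)) = act V h (f s)" if s: "s \<in> S" and h: "h = uq_E \<or> h = uq_K" for s h
  proof -
    obtain l k where lk: "s = (l, k)" "l \<in> J" "k \<le> r l" using s by (auto simp: S_def)
    have hc: "h \<in> carrier (uq_alg q d)" using h c by auto
    have inS: "(l, b) \<in> S" if "b \<in> {0..r l}" for b using that lk by (auto simp: S_def)
    have "linext S f (act ?W h (bvec s)) =
        linext {0..r l} (\<lambda>b. linext S f (bvec (l, b))) (act (indec q d (m l) (r l)) h (bvec k))"
      by (simp only: lk(1) actW [OF s [unfolded lk(1)] hc] linext_linext)
    also have "\<dots> = linext {0..r l} (\<lambda>b. f (l, b)) (act (indec q d (m l) (r l)) h (bvec k))"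
      using inS S by (intro linext_cong linext_bvec)
    also have "\<dots> = act V h (f s)"
      using h
    proof
      assume h: "h = uq_E"
      show ?thesis
      proof (cases "k < r l")
        case True
        then show ?thesis using lk d by (simp add: h indec_act_E linext_bvec f_def)
      next
        case False
        then show ?thesis using lk d wE [OF lk(2)]
          by (simp add: h indec_act_E linext_vzero f_def)
      qed
    next
      assume h: "h = uq_K"
      show ?thesis
        using lk d act_K_E_pow [OF V d q0 w [OF lk(2)] wK [OF lk(2)]]
        by (simp add: h indec_act_K linext_vscale linext_bvec f_def)
    qed
    finally show ?thesis .
  qed
  have "linext S f (act ?W h x) = act V h (linext S f x)"
    if h: "h = uq_E \<or> h = uq_K" and x: "x \<in> space ?W" for h x
  proof -
    have hc: "h \<in> carrier (uq_alg q d)" using h c by auto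
    have "act ?W h x = act ?W h (linext S bvec x)"
      using x S by (simp add: linext_id space_def idxW)
    also have "\<dots> = linext S (\<lambda>s. act ?W h (bvec s)) x"
      using W hc S by (rule act_linext) (simp add: space_def idxW)
    finally have "linext S f (act ?W h x) = linext S (\<lambda>s. linext S f (act ?W h (bvec s))) x"
      by (simp add: linext_linext)
    also have "\<dots> = linext S (\<lambda>s. act V h (f s)) x"
      using h by (intro linext_cong f_act)
    also have "\<dots> = act V h (linext S f x)"
      using V hc S f by (intro act_linext [symmetric])
    finally show ?thesis .
  qed
  then have "isomorphic_modules (uq_alg q d) ?W V"
    by (intro isomorphic_modules_generatorsI [OF W V d bij linear_op_linext]) auto
  then show ?thesis by (rule isomorphic_modules_sym)
qed

section \<open>The raising operator on the tensor product\<close>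

text \<open>Up to the factor \<open>(1 - p)\<^sup>k\<close> this is the \<open>p\<close>-factorial of \<open>k\<close>. The factors cancel in the ratios
  \<open>qfac k / (qfac m * qfac (k - m))\<close>, which are the \<open>p\<close>-binomial coefficients.\<close>

definition qfac :: "complex \<Rightarrow> nat \<Rightarrow> complex" where
  "qfac p k = (\<Prod>t = 1..k. 1 - p ^ t)"

lemma qfac_0 [simp]: "qfac p 0 = 1"
  by (simp add: qfac_def)

lemma qfac_Suc [simp]: "qfac p (Suc k) = (1 - p ^ Suc k) * qfac p k"
  by (simp add: qfac_def prod.nat_ivl_Suc' mult.commute)

text \<open>The basis vector \<open>e\<^sup>a \<otimes> e\<^sup>b\<close> of \<open>M\<^sub>i\<^sup>u \<otimes> M\<^sub>j\<^sup>v\<close> has index \<open>(a, b)\<close>. The modules enter through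
  \<open>p = q\<^sup>2\<close> and through the eigenvalue \<open>\<kappa> = q\<^bsup>2j\<^esup>\<close> of \<open>K\<close> on \<open>e\<^sub>j\<^sup>0\<close>.\<close>

locale tensor_grid =
  fixes p \<kappa> :: complex and u v d :: nat
  assumes p_pow_d: "p ^ d = 1"
    and p_pow: "0 < k \<Longrightarrow> k < d \<Longrightarrow> p ^ k \<noteq> 1"
    and kappa: "\<kappa> \<noteq> 0"
    and u_less: "u < d" and v_less: "v < d"
begin

abbreviation grid :: "(nat \<times> nat) set" where
  "grid \<equiv> {0..u} \<times> {0..v}"

text \<open>The operator \<open>1 \<otimes> E + E \<otimes> K\<close>, that is
  \<open>e\<^sup>a \<otimes> e\<^sup>b \<mapsto> e\<^sup>a \<otimes> e\<^bsup>b+1\<^esup> + \<kappa> p\<^sup>b e\<^bsup>a+1\<^esup> \<otimes> e\<^sup>b\<close>.\<close>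

definition raise :: "(nat \<times> nat \<Rightarrow> complex) \<Rightarrow> nat \<times> nat \<Rightarrow> complex" where
  "raise x = (\<lambda>(a, b). if a \<le> u \<and> b \<le> v
     then (if b = 0 then 0 else x (a, b - 1)) + (if a = 0 then 0 else \<kappa> * p ^ b * x (a - 1, b))
     else 0)"

text \<open>A version of the action of the generator \<open>F\<close> of the quantum group of \<open>sl\<^sub>2\<close>:
  \<open>e\<^sup>a \<otimes> e\<^sup>b \<mapsto> f\<^sub>a e\<^bsup>a-1\<^esup> \<otimes> e\<^sup>b + \<kappa> p\<^bsup>u-a\<^esup> g\<^sub>b e\<^sup>a \<otimes> e\<^bsup>b-1\<^esup>\<close> with
  \<open>f\<^sub>a = (1 - p\<^sup>a) (1 - p\<^bsup>u+1-a\<^esup>)\<close> and \<open>g\<^sub>b = (1 - p\<^sup>b) (1 - p\<^bsup>v+1-b\<^esup>)\<close>. The factor \<open>\<kappa> p\<^bsup>u-a\<^esup>\<close> is chosen so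
  that the mixed terms in the commutator with \<open>raise\<close> cancel and the diagonal ones depend only on
  \<open>a + b\<close>.\<close>

definition lower :: "(nat \<times> nat \<Rightarrow> complex) \<Rightarrow> nat \<times> nat \<Rightarrow> complex" where
  "lower x = (\<lambda>(a, b). if a \<le> u \<and> b \<le> v
     then (1 - p ^ (a + 1)) * (1 - p ^ (u - a)) * x (a + 1, b)
        + \<kappa> * p ^ (u - a) * (1 - p ^ (b + 1)) * (1 - p ^ (v - b)) * x (a, b + 1)
     else 0)"

definition homog :: "nat \<Rightarrow> (nat \<times> nat \<Rightarrow> complex) \<Rightarrow> bool" where
  "homog s x \<longleftrightarrow> (\<forall>a b. x (a, b) \<noteq> 0 \<longrightarrow> a \<le> u \<and> b \<le> v \<and> a + b = s)"

lemma p_nz: "p \<noteq> 0"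
  using p_pow_d u_less by (auto simp: power_0_left)

lemma qfac_nz: "k < d \<Longrightarrow> qfac p k \<noteq> 0"
  using p_pow by (simp add: qfac_def)

lemma homog_cspace: "homog s x \<Longrightarrow> x \<in> cspace grid"
  by (auto simp: homog_def cspace_def)

lemma raise_cspace: "raise x \<in> cspace grid"
  by (auto simp: raise_def cspace_def)

lemma raise_linext: "raise (linext A f x) = linext A (\<lambda>a. raise (f a)) x"
  by (auto simp: raise_def linext_def fun_eq_iff sum_distrib_left sum.distrib algebra_simps)

lemma raise_pow_linext: "(raise ^^ k) (linext A f x) = linext A (\<lambda>a. (raise ^^ k) (f a)) x"
  by (induction k) (simp_all add: raise_linext)

lemma raise_vscale: "raise (vscale c x) = vscale c (raise x)"
  by (auto simp: raise_def vscale_def fun_eq_iff algebra_simps)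

lemma raise_vzero: "raise vzero = vzero"
  by (auto simp: raise_def vzero_def fun_eq_iff)

lemma raise_homog: "homog s x \<Longrightarrow> homog (Suc s) (raise x)"
  unfolding homog_def
proof (intro allI impI)
  fix a b
  assume x: "\<forall>a b. x (a, b) \<noteq> 0 \<longrightarrow> a \<le> u \<and> b \<le> v \<and> a + b = s" and "raise x (a, b) \<noteq> 0"
  then have "a \<le> u \<and> b \<le> v" "(b \<noteq> 0 \<and> x (a, b - 1) \<noteq> 0) \<or> (a \<noteq> 0 \<and> x (a - 1, b) \<noteq> 0)"
    by (auto simp: raise_def split: if_splits)
  with x show "a \<le> u \<and> b \<le> v \<and> a + b = Suc s"
    by (metis Suc_pred add_Suc add_Suc_right bot_nat_0.not_eq_extremum diff_Suc_1)
qed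

lemma raise_pow_homog: "homog s x \<Longrightarrow> homog (s + k) ((raise ^^ k) x)"
  by (induction k) (simp_all add: raise_homog)

text \<open>The \<open>p\<close>-binomial theorem for the \<open>p\<close>-commuting summands \<open>1 \<otimes> E\<close> and \<open>E \<otimes> K\<close>. The induction step
  is the Pascal rule, which for the coefficients \<open>1 / (qfac m * qfac n)\<close> with \<open>m + n = k + 1\<close> says
  \<open>(1 - p\<^sup>n) + p\<^sup>n (1 - p\<^sup>m) = 1 - p\<^bsup>k+1\<^esup>\<close>. It holds for all \<open>k\<close>, also beyond \<open>d\<close>: only
  \<open>m \<le> u\<close> and \<open>n \<le> v\<close> occur, so the denominators never vanish.\<close>

lemma raise_pow_bvec:
  assumes "a \<le> u" "b \<le> v"
  shows "(raise ^^ k) (bvec (a, b)) (a', b') =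
    (if a \<le> a' \<and> a' \<le> u \<and> b \<le> b' \<and> b' \<le> v \<and> a' + b' = a + b + k
     then qfac p k * \<kappa> ^ (a' - a) * p ^ ((a' - a) * b) / (qfac p (a' - a) * qfac p (b' - b)) else 0)"
proof (induction k arbitrary: a' b')
  case 0
  then show ?case using assms by (auto simp: bvec_def)
next
  case (Suc k)
  show ?case
  proof (cases "a \<le> a' \<and> a' \<le> u \<and> b \<le> b' \<and> b' \<le> v \<and> a' + b' = a + b + Suc k")
    case False
    have "(raise ^^ k) (bvec (a, b)) (a', b' - 1) = 0" if "b' \<noteq> 0" "b' \<le> v"
    proof -
      have "\<not> (a \<le> a' \<and> a' \<le> u \<and> b \<le> b' - 1 \<and> b' - 1 \<le> v \<and> a' + (b' - 1) = a + b + k)"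
        using that False by linarith
      then show ?thesis unfolding Suc.IH by (rule if_not_P)
    qed
    moreover have "(raise ^^ k) (bvec (a, b)) (a' - 1, b') = 0" if "a' \<noteq> 0" "a' \<le> u"
    proof -
      have "\<not> (a \<le> a' - 1 \<and> a' - 1 \<le> u \<and> b \<le> b' \<and> b' \<le> v \<and> a' - 1 + b' = a + b + k)"
        using that False by linarith
      then show ?thesis unfolding Suc.IH by (rule if_not_P)
    qed
    ultimately have "(raise ^^ Suc k) (bvec (a, b)) (a', b') = 0"
      by (cases "a' = 0"; cases "b' = 0") (simp_all add: raise_def)
    then show ?thesis unfolding if_not_P [OF False] .
  next
    case True
    define m n where "m = a' - a" and "n = b' - b"
    have eq: "a' = a + m" "b' = b + n" "m + n = Suc k" "m < d" "n < d"
      using True u_less v_less by (auto simp: m_def n_def)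
    note nz = qfac_nz [OF eq(4)] qfac_nz [OF eq(5)]
    let ?y = "(raise ^^ k) (bvec (a, b))"
    define c where "c = qfac p k * \<kappa> ^ m * p ^ (m * b) / (qfac p m * qfac p n)"
    have cancel: "t \<noteq> 0 \<Longrightarrow> x / (t * y) * t = x / y" for t x y :: complex by simp
    have 1: "(if b' = 0 then 0 else ?y (a', b' - 1)) = c * (1 - p ^ n)"
    proof (cases n)
      case 0
      then show ?thesis using eq True by (auto simp: Suc c_def)
    next
      case (Suc n')
      have "1 - p ^ Suc n' \<noteq> 0" using nz(2) Suc by auto
      from cancel [OF this, of "qfac p k * \<kappa> ^ m * p ^ (m * b)" "qfac p m * qfac p n'"]
      have "c * (1 - p ^ n) = qfac p k * \<kappa> ^ m * p ^ (m * b) / (qfac p m * qfac p n')"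
        unfolding c_def Suc qfac_Suc mult.left_commute [of "qfac p m"] .
      then show ?thesis using eq True Suc.IH Suc by (simp add: m_def [symmetric])
    qed
    have 2: "(if a' = 0 then 0 else \<kappa> * p ^ b' * ?y (a' - 1, b')) = c * p ^ n * (1 - p ^ m)"
    proof (cases m)
      case 0
      then show ?thesis using eq True by (auto simp: Suc c_def)
    next
      case (Suc m')
      have "1 - p ^ Suc m' \<noteq> 0" using nz(1) Suc by auto
      from cancel [OF this, of "qfac p k * \<kappa> ^ m * p ^ (m * b)" "qfac p m' * qfac p n"]
      have "c * (1 - p ^ m) = qfac p k * \<kappa> ^ m * p ^ (m * b) / (qfac p m' * qfac p n)"
        unfolding c_def Suc qfac_Suc mult.assoc .
      moreover have "c * p ^ n * (1 - p ^ m) = p ^ n * (c * (1 - p ^ m))"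
        by (simp only: ac_simps)
      ultimately have "c * p ^ n * (1 - p ^ m) =
          p ^ n * (qfac p k * \<kappa> ^ m * p ^ (m * b) / (qfac p m' * qfac p n))"
        by simp
      moreover have "a' \<noteq> 0" "?y (a' - 1, b') =
          qfac p k * \<kappa> ^ m' * p ^ (m' * b) / (qfac p m' * qfac p n)"
      proof -
        show "a' \<noteq> 0" using eq Suc by simp
        have "a \<le> a' - 1 \<and> a' - 1 \<le> u \<and> b \<le> b' \<and> b' \<le> v \<and> a' - 1 + b' = a + b + k"
          using eq Suc True by auto
        moreover have "a' - 1 - a = m'" using eq Suc by simp
        ultimately show "?y (a' - 1, b') = qfac p k * \<kappa> ^ m' * p ^ (m' * b) / (qfac p m' * qfac p n)"
          by (simp only: Suc.IH if_P n_def)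
      qed
      ultimately show ?thesis by (simp add: Suc eq(2) power_add)
    qed
    have "(raise ^^ Suc k) (bvec (a, b)) (a', b') = c * (1 - p ^ n) + c * p ^ n * (1 - p ^ m)"
      using True by (simp add: raise_def 1 [symmetric] 2 [symmetric])
    also have "\<dots> = c * (1 - p ^ (m + n))"
      by (simp add: algebra_simps power_add)
    also have "\<dots> = qfac p (Suc k) * \<kappa> ^ m * p ^ (m * b) / (qfac p m * qfac p n)"
      by (simp add: c_def eq(3))
    finally show ?thesis using True by (simp add: m_def n_def)
  qed
qed

text \<open>All coefficients of the \<open>d\<close>-th power contain the factor \<open>1 - p\<^sup>d = 0\<close>.\<close>

lemma raise_pow_d:
  assumes "x \<in> cspace grid"
  shows "(raise ^^ d) x = vzero"
proof -
  have "qfac p d = 0"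
    using p_pow_d u_less by (cases d) auto
  then have "(raise ^^ d) (bvec ab) = vzero" if "ab \<in> grid" for ab
    using that by (cases ab) (auto simp: raise_pow_bvec vzero_def fun_eq_iff)
  then have "(raise ^^ d) (linext grid bvec x) = vzero"
    by (simp add: raise_pow_linext linext_vzero cong: linext_cong)
  then show ?thesis using assms by (simp add: linext_id)
qed

lemma long_string:
  assumes "l + (d - 1) \<le> u + v" "l \<le> u"
  shows "(raise ^^ (d - 1)) (bvec (l, 0)) \<noteq> vzero"
proof -
  \<comment> \<open>The point of the grid with first coordinate \<open>u\<close>: its second coordinate is at most \<open>v\<close> exactly
    because \<open>l + (d - 1) \<le> u + v\<close>.\<close>
  have "(raise ^^ (d - 1)) (bvec (l, 0)) (u, l + (d - 1) - u) \<noteq> 0"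
    using assms u_less v_less kappa qfac_nz [of "d - 1"] qfac_nz [of "u - l"]
      qfac_nz [of "l + (d - 1) - u"]
    by (auto simp: raise_pow_bvec)
  then show ?thesis by (auto simp: vzero_def)
qed

text \<open>The mixed terms, with \<open>x (a + 1, b - 1)\<close> and \<open>x (a - 1, b + 1)\<close>, are the same on both sides. The
  diagonal terms differ by
  \<open>\<kappa> p\<^sup>b (f\<^bsub>a+1\<^esub> - f\<^sub>a) + \<kappa> p\<^bsup>u-a\<^esup> (g\<^bsub>b+1\<^esub> - g\<^sub>b)\<close>, in the notation of the comment on \<open>lower\<close>, where
  \<open>f\<^bsub>a+1\<^esub> - f\<^sub>a = (1 - p) (p\<^sup>a - p\<^bsup>u-a\<^esup>)\<close> and likewise for \<open>g\<close>; the terms \<open>p\<^bsup>u-a+b\<^esup>\<close> cancel.\<close>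

lemma lower_raise:
  assumes "x \<in> cspace grid" "a \<le> u" "b \<le> v"
  shows "lower (raise x) (a, b) = raise (lower x) (a, b)
    + (1 - p) * \<kappa> * (p ^ (a + b) - p ^ ((u - a) + (v - b))) * x (a, b)"
proof -
  define a' b' where "a' = u - a" and "b' = v - b"
  have up: "lower (raise x) (a, b) =
      (1 - p ^ (a + 1)) * (1 - p ^ a') * ((if b = 0 then 0 else x (a + 1, b - 1)) + \<kappa> * p ^ b * x (a, b))
    + \<kappa> * p ^ a' * (1 - p ^ (b + 1)) * (1 - p ^ b') *
       (x (a, b) + (if a = 0 then 0 else \<kappa> * p ^ (b + 1) * x (a - 1, b + 1)))"
    using assms(2,3) by (cases "a = u"; cases "b = v") (simp_all add: lower_def raise_def a'_def b'_def)
  have "v - (b - 1) = b' + 1" if "b \<noteq> 0"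
    using that assms by (simp add: b'_def)
  then have 1: "(if b = 0 then 0 else lower x (a, b - 1)) =
      (1 - p ^ (a + 1)) * (1 - p ^ a') * (if b = 0 then 0 else x (a + 1, b - 1))
      + \<kappa> * p ^ a' * (1 - p ^ b) * (1 - p ^ (b' + 1)) * x (a, b)"
    using assms(2,3) by (cases "b = 0") (auto simp: lower_def a'_def)
  have "u - (a - 1) = a' + 1" if "a \<noteq> 0"
    using that assms by (simp add: a'_def)
  then have 2: "(if a = 0 then 0 else lower x (a - 1, b)) = (1 - p ^ a) * (1 - p ^ (a' + 1)) * x (a, b)
      + \<kappa> * p ^ (a' + 1) * (1 - p ^ (b + 1)) * (1 - p ^ b') * (if a = 0 then 0 else x (a - 1, b + 1))"
    using assms(2,3) by (cases "a = 0") (auto simp: lower_def b'_def)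
  define X where "X = (if b = 0 then 0 else x (a + 1, b - 1))"
  define Y where "Y = (if a = 0 then 0 else x (a - 1, b + 1))"
  have "(if a = 0 then 0 else \<kappa> * p ^ (b + 1) * x (a - 1, b + 1)) = \<kappa> * p ^ (b + 1) * Y"
    by (simp add: Y_def)
  note up = up [unfolded this, folded X_def]
  have "raise (lower x) (a, b) = (if b = 0 then 0 else lower x (a, b - 1))
      + \<kappa> * p ^ b * (if a = 0 then 0 else lower x (a - 1, b))"
    using assms by (simp add: raise_def)
  note down = this [unfolded 1 2, folded X_def Y_def]
  show ?thesis
    unfolding up down a'_def [symmetric] b'_def [symmetric]
    by (simp add: algebra_simps power_add)
qed

text \<open>In degree \<open>s > v\<close> the vector \<open>e\<^sup>0 \<otimes> e\<^sup>s\<close> does not exist, so \<open>x (0, s) = 0\<close>, and the equation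
  \<open>lower x (a, b) = 0\<close> determines \<open>x (a + 1, b)\<close> from \<open>x (a, b + 1)\<close>.\<close>

lemma lower_injective:
  assumes x: "homog s x" and s: "v < s" and 0: "lower x = vzero"
  shows "x = vzero"
proof -
  have "x (a, b) = 0" if "a + b = s" for a b
    using that
  proof (induction a arbitrary: b)
    case 0
    then show ?case using x s by (fastforce simp: homog_def)
  next
    case (Suc a)
    show ?case
    proof (cases "Suc a \<le> u \<and> b \<le> v")
      case True
      have "x (a, b + 1) = 0" using Suc by simp
      moreover have "lower x (a, b) = 0" using 0 by (simp add: vzero_def)
      ultimately have "(1 - p ^ (a + 1)) * (1 - p ^ (u - a)) * x (a + 1, b) = 0"
        using True by (simp add: lower_def)
      moreover have "p ^ (a + 1) \<noteq> 1" "p ^ (u - a) \<noteq> 1"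
        using True u_less p_pow [of "a + 1"] p_pow [of "u - a"] by auto
      ultimately show ?thesis by simp
    next
      case False
      then show ?thesis using x by (auto simp: homog_def)
    qed
  qed
  moreover have "x (a, b) = 0" if "a + b \<noteq> s" for a b
    using that x by (auto simp: homog_def)
  ultimately have "x (a, b) = 0" for a b by blast
  then show ?thesis by (simp add: vzero_def fun_eq_iff)
qed

text \<open>The equations \<open>lower x (a, l - 1 - a) = 0\<close> solved for \<open>x (a + 1, l - 1 - a)\<close>. In degrees \<open>l \<le> u\<close> the
  divisor is nonzero whenever \<open>a < l\<close>, and for \<open>l \<le> min u v\<close> the recursion starts freely at
  \<open>a = 0\<close>. The exponent \<open>v + 1 + a - l\<close> is \<open>v - b\<close> for \<open>b = l - 1 - a\<close>.\<close>

primrec lowest_coeff :: "nat \<Rightarrow> nat \<Rightarrow> complex" where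
  "lowest_coeff l 0 = 1"
| "lowest_coeff l (Suc a) =
     - (\<kappa> * p ^ (u - a) * (1 - p ^ (l - a)) * (1 - p ^ (v + 1 + a - l)))
       / ((1 - p ^ (a + 1)) * (1 - p ^ (u - a))) * lowest_coeff l a"

definition lowest :: "nat \<Rightarrow> nat \<times> nat \<Rightarrow> complex" where
  "lowest l = (\<lambda>(a, b). if a + b = l then lowest_coeff l a else 0)"

lemma lowest_homog: "l \<le> min u v \<Longrightarrow> homog l (lowest l)"
  by (auto simp: lowest_def homog_def)

lemma lowest_nz: "lowest l \<noteq> vzero"
proof
  assume "lowest l = vzero"
  from fun_cong [OF this, of "(0, l)"] show False by (simp add: lowest_def vzero_def)
qed

lemma lower_lowest:
  assumes l: "l \<le> min u v"
  shows "lower (lowest l) = vzero"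
proof -
  have "lower (lowest l) (a, b) = 0" if "a \<le> u" "b \<le> v" for a b
  proof (cases "a + b + 1 = l")
    case True
    then have eq: "l - a = b + 1" "v + 1 + a - l = v - b" by auto
    have "p ^ (a + 1) \<noteq> 1" "p ^ (u - a) \<noteq> 1"
      using True l u_less p_pow [of "a + 1"] p_pow [of "u - a"] by auto
    then have nz: "(1 - p ^ (a + 1)) * (1 - p ^ (u - a)) \<noteq> 0" by simp
    have "lower (lowest l) (a, b) =
        (1 - p ^ (a + 1)) * (1 - p ^ (u - a)) * lowest_coeff l (Suc a)
        + \<kappa> * p ^ (u - a) * (1 - p ^ (b + 1)) * (1 - p ^ (v - b)) * lowest_coeff l a"
      using True that by (simp add: lower_def lowest_def)
    also have "\<dots> = 0"
      using nz by (simp only: lowest_coeff.simps eq) (simp add: field_simps)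
    finally show ?thesis .
  next
    case False
    then show ?thesis by (simp add: lower_def lowest_def)
  qed
  then show ?thesis by (auto simp: vzero_def fun_eq_iff lower_def)
qed

lemma lower_raise_homog:
  assumes "homog s x" "s \<le> u + v"
  shows "lower (raise x) = vadd (raise (lower x))
    (vscale ((1 - p) * \<kappa> * (p ^ s - p ^ (u + v - s))) x)"
proof -
  have "lower (raise x) (a, b) = raise (lower x) (a, b)
    + (1 - p) * \<kappa> * (p ^ s - p ^ (u + v - s)) * x (a, b)" for a b
  proof (cases "a \<le> u \<and> b \<le> v \<and> a + b = s")
    case True
    then have "(u - a) + (v - b) = u + v - s" using assms by auto
    with True lower_raise [OF homog_cspace [OF assms(1)]] show ?thesis by auto
  next
    case False
    then have "x (a, b) = 0" using assms(1) by (auto simp: homog_def)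
    moreover have "lower (raise x) (a, b) = raise (lower x) (a, b)" if "\<not> (a \<le> u \<and> b \<le> v)"
      using that by (auto simp: lower_def raise_def)
    ultimately show ?thesis using lower_raise [OF homog_cspace [OF assms(1)], of a b]
      by (cases "a \<le> u \<and> b \<le> v") auto
  qed
  then show ?thesis by (auto simp: vadd_def vscale_def fun_eq_iff)
qed

text \<open>Summing the commutators over the degrees \<open>l, \<dots>, l + k\<close>; the sum telescopes because
  \<open>(1 - p) (p\<^sup>t - p\<^bsup>r-t\<^esup>)\<close> is the difference of \<open>(1 - p\<^sup>t) (1 - p\<^bsup>r+1-t\<^esup>)\<close> at \<open>t + 1\<close> and \<open>t\<close>, with
  \<open>r = u + v - 2l\<close>.\<close>

lemma lower_raise_pow:
  assumes w: "homog l w" "lower w = vzero" and k: "2 * l + k \<le> u + v"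
  shows "lower ((raise ^^ Suc k) w) =
    vscale (\<kappa> * p ^ l * (1 - p ^ Suc k) * (1 - p ^ (u + v - 2 * l - k))) ((raise ^^ k) w)"
  using k
proof (induction k)
  case 0
  have "p ^ (u + v - l) = p ^ l * p ^ (u + v - 2 * l)"
    using 0 by (simp flip: power_add)
  then show ?case using 0 w
    by (simp add: lower_raise_homog raise_vzero)
      (simp add: vadd_def vscale_def vzero_def fun_eq_iff algebra_simps)
next
  case (Suc k)
  define r where "r = u + v - 2 * l - Suc k"
  have r: "u + v - (l + Suc k) = l + r" "u + v - 2 * l - k = r + 1"
    using Suc.prems by (auto simp: r_def)
  have "lower ((raise ^^ Suc (Suc k)) w) = vadd (raise (lower ((raise ^^ Suc k) w)))
    (vscale ((1 - p) * \<kappa> * (p ^ (l + Suc k) - p ^ (l + r))) ((raise ^^ Suc k) w))"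
    using lower_raise_homog [OF raise_pow_homog [OF w(1), of "Suc k"]] Suc.prems
    by (simp only: funpow.simps o_apply r)
  also have "lower ((raise ^^ Suc k) w) =
    vscale (\<kappa> * p ^ l * (1 - p ^ Suc k) * (1 - p ^ (r + 1))) ((raise ^^ k) w)"
    using Suc by (simp only: r)
  also have "vadd (raise \<dots>)
      (vscale ((1 - p) * \<kappa> * (p ^ (l + Suc k) - p ^ (l + r))) ((raise ^^ Suc k) w))
     = vscale (\<kappa> * p ^ l * (1 - p ^ Suc (Suc k)) * (1 - p ^ r)) ((raise ^^ Suc k) w)"
    by (simp add: raise_vscale)
      (simp add: vadd_def vscale_def fun_eq_iff algebra_simps power_add)
  finally show ?case by (simp add: r_def)
qed

text \<open>The scalar in \<open>lower_raise_pow\<close> is nonzero for \<open>k < u + v - 2l\<close>, since both exponents of \<open>p\<close> lie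
  strictly between \<open>0\<close> and \<open>d\<close>, and it is zero for \<open>k = u + v - 2l\<close>. In the latter case
  \<open>lower_injective\<close> applies, because \<open>l \<le> u\<close> puts the degree \<open>u + v - l + 1\<close> above \<open>v\<close>.\<close>

lemma short_string:
  assumes l: "l \<le> min u v" and r: "u + v - 2 * l < d"
  shows "(raise ^^ (u + v - 2 * l)) (lowest l) \<noteq> vzero"
    and "(raise ^^ Suc (u + v - 2 * l)) (lowest l) = vzero"
proof -
  note w = lowest_homog [OF l] lower_lowest [OF l]
  have "(raise ^^ k) (lowest l) \<noteq> vzero" if "k \<le> u + v - 2 * l" for k
    using that
  proof (induction k)
    case 0
    then show ?case by (simp add: lowest_nz)
  next
    case (Suc k)
    have "p ^ Suc k \<noteq> 1" "p ^ (u + v - 2 * l - k) \<noteq> 1"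
      using Suc.prems r p_pow [of "Suc k"] p_pow [of "u + v - 2 * l - k"] by auto
    then have "\<kappa> * p ^ l * (1 - p ^ Suc k) * (1 - p ^ (u + v - 2 * l - k)) \<noteq> 0"
      using kappa p_nz by simp
    moreover have "lower ((raise ^^ Suc k) (lowest l)) =
      vscale (\<kappa> * p ^ l * (1 - p ^ Suc k) * (1 - p ^ (u + v - 2 * l - k))) ((raise ^^ k) (lowest l))"
      using Suc.prems l by (intro lower_raise_pow w) auto
    moreover have "(raise ^^ k) (lowest l) \<noteq> vzero" using Suc by simp
    ultimately have "lower ((raise ^^ Suc k) (lowest l)) \<noteq> vzero"
      by (auto simp: vscale_def vzero_def fun_eq_iff)
    moreover have "lower vzero = vzero" by (auto simp: lower_def vzero_def fun_eq_iff)
    ultimately show ?case by metis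
  qed
  then show "(raise ^^ (u + v - 2 * l)) (lowest l) \<noteq> vzero" by simp
  have "lower ((raise ^^ Suc (u + v - 2 * l)) (lowest l)) = vzero"
    using l by (subst lower_raise_pow [OF w]) (auto simp: vscale_def vzero_def)
  moreover have "v < l + Suc (u + v - 2 * l)" using l by auto
  ultimately show "(raise ^^ Suc (u + v - 2 * l)) (lowest l) = vzero"
    by (intro lower_injective [OF raise_pow_homog [OF w(1)]])
qed

end

section \<open>Tensor products\<close>

lemma tens_bvec: "tens (bvec a) (bvec b) = bvec (a, b)"
  by (auto simp: tens_def bvec_def fun_eq_iff)

lemma tens_linext:
  "tens (linext A f x) (linext B g y) = linext (A \<times> B) (\<lambda>(a, b). tens (f a) (g b)) (tens x y)"
proof (rule ext, clarify)
  fix a' b'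
  have "(\<Sum>a\<in>A. x a * f a a') * (\<Sum>b\<in>B. y b * g b b') =
      (\<Sum>(a, b)\<in>A \<times> B. x a * f a a' * (y b * g b b'))"
    by (simp add: sum_product sum.cartesian_product)
  also have "\<dots> = (\<Sum>(a, b)\<in>A \<times> B. x a * y b * (f a a' * g b b'))"
    by (rule sum.cong) (auto simp: algebra_simps)
  finally show "tens (linext A f x) (linext B g y) (a', b') =
      linext (A \<times> B) (\<lambda>(a, b). tens (f a) (g b)) (tens x y) (a', b')"
    by (simp add: tens_def linext_def split_def)
qed

lemma tens_cspace: "x \<in> cspace A \<Longrightarrow> y \<in> cspace B \<Longrightarrow> tens x y \<in> cspace (A \<times> B)"
  by (auto simp: cspace_def tens_def)

lemma tens_vzero: "tens vzero x = vzero" "tens x vzero = vzero"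
  by (auto simp: tens_def vzero_def)

lemma tens_vscale: "tens (vscale c x) y = vscale c (tens x y)" "tens x (vscale c y) = vscale c (tens x y)"
  by (auto simp: tens_def vscale_def)

locale two_modules =
  fixes q :: complex and d :: nat and V :: "(nat \<times> nat, 'a) fdmod" and W :: "(nat \<times> nat, 'c) fdmod"
  assumes d: "d > 1"
    and V: "is_left_module (uq_alg q d) V" and W: "is_left_module (uq_alg q d) W"
begin

abbreviation "B \<equiv> uq_basis d"

text \<open>The action on \<open>V \<otimes> W\<close> of the tensor square of the algebra. The module structure of the tensor
  product is its restriction along the comultiplication.\<close>

definition tensor_act ::
  "((nat \<times> nat) \<times> (nat \<times> nat) \<Rightarrow> complex) \<Rightarrow> ('a \<times> 'c \<Rightarrow> complex) \<Rightarrow> 'a \<times> 'c \<Rightarrow> complex" where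
  "tensor_act z x = linext (B \<times> B) (\<lambda>(p, r). linext (idx V \<times> idx W)
     (\<lambda>(a, c). tens (act V (bvec p) (bvec a)) (act W (bvec r) (bvec c))) x) z"

lemma idx_uq_tensor: "idx (uq_tensor q d V W) = idx V \<times> idx W"
  by (simp add: tensor_module_def)

lemma act_uq_tensor: "act (uq_tensor q d V W) h = tensor_act (uq_comult q d h)"
  by (rule ext) (simp add: tensor_module_def tensor_act_def)

lemma fin: "finite (idx V)" "finite (idx W)"
  using left_moduleD(1) V W by auto

lemma tensor_act_linear: "linear_op (tensor_act z)"
  by (simp add: linear_op_def tensor_act_def linext_vadd linext_vscale linext_vadd_fun
      linext_vscale_fun split_def)

lemma tensor_act_linear_alg: "linear_op (\<lambda>z. tensor_act z x)"
  by (simp add: linear_op_def tensor_act_def linext_vadd linext_vscale)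

lemma act_cspace:
  "h \<in> cspace B \<Longrightarrow> x \<in> cspace (idx V) \<Longrightarrow> act V h x \<in> cspace (idx V)"
  "h \<in> cspace B \<Longrightarrow> y \<in> cspace (idx W) \<Longrightarrow> act W h y \<in> cspace (idx W)"
  using left_moduleD(2) [OF V] left_moduleD(2) [OF W] by (auto simp: uq_carrier space_def)

lemma tensor_act_cspace: "tensor_act z x \<in> cspace (idx V \<times> idx W)"
  unfolding tensor_act_def
  by (intro linext_cspace) (auto intro!: linext_cspace tens_cspace act_cspace)

lemma act_expand:
  assumes "is_left_module (uq_alg q d) U" "g \<in> cspace B" "y \<in> cspace (idx U)"
  shows "act U g y = linext B (\<lambda>p. linext (idx U) (\<lambda>a. act U (bvec p) (bvec a)) y) g"
proof -
  have "act U g y = act U (linext B bvec g) y"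
    using assms by (simp add: linext_id)
  also have "\<dots> = linext B (\<lambda>p. act U (bvec p) y) g"
    using assms unfolding uq_alg_def by (intro act_linext_alg) (auto simp: space_def)
  also have "\<dots> = linext B (\<lambda>p. linext (idx U) (\<lambda>a. act U (bvec p) (bvec a)) y) g"
  proof (rule linext_cong)
    fix p assume p: "p \<in> B"
    have "act U (bvec p) y = act U (bvec p) (linext (idx U) bvec y)"
      using assms left_moduleD(1) [OF assms(1)] by (simp add: linext_id)
    also have "\<dots> = linext (idx U) (\<lambda>a. act U (bvec p) (bvec a)) y"
      using p left_moduleD(1) [OF assms(1)]
      by (intro act_linext [OF assms(1)]) (auto simp: uq_carrier)
    finally show "act U (bvec p) y = linext (idx U) (\<lambda>a. act U (bvec p) (bvec a)) y" .
  qed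
  finally show ?thesis .
qed

lemma tensor_act_tens:
  assumes "g \<in> cspace B" "g' \<in> cspace B" "y \<in> cspace (idx V)" "y' \<in> cspace (idx W)"
  shows "tensor_act (tens g g') (tens y y') = tens (act V g y) (act W g' y')"
proof -
  have "tens (act V g y) (act W g' y') = tens
      (linext B (\<lambda>p. linext (idx V) (\<lambda>a. act V (bvec p) (bvec a)) y) g)
      (linext B (\<lambda>p. linext (idx W) (\<lambda>a. act W (bvec p) (bvec a)) y') g')"
    using assms act_expand V W by metis
  also have "\<dots> = tensor_act (tens g g') (tens y y')"
    by (simp add: tensor_act_def tens_linext)
  finally show ?thesis by simp
qed

lemma uq_mult_cspace: "p \<in> B \<Longrightarrow> r \<in> B \<Longrightarrow> bvec p \<otimes>\<^bsub>uq_alg q d\<^esub> bvec r \<in> cspace B"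
  using d by (cases p; cases r) (auto simp: uq_alg_mult_bvec uq_basis_def)

text \<open>On basis elements and basis vectors this is the associativity of the actions on \<open>V\<close> and on \<open>W\<close>; the
  general case follows by multilinearity.\<close>

lemma tensor_act_mult:
  assumes x: "x \<in> cspace (idx V \<times> idx W)"
  shows "tensor_act (z \<otimes>\<^bsub>uq_tensor_alg q d\<^esub> z') x = tensor_act z (tensor_act z' x)"
proof -
  define F where "F = (\<lambda>P ac. tensor_act (bvec P) (bvec ac))"
  let ?I = "idx V \<times> idx W" and ?BB = "B \<times> B"
  let ?m = "\<lambda>(p, r) (p', r').
    tens (bvec p \<otimes>\<^bsub>uq_alg q d\<^esub> bvec p') (bvec r \<otimes>\<^bsub>uq_alg q d\<^esub> bvec r')"
  have fin': "finite ?I" "finite ?BB" using fin by auto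
  have exp: "tensor_act z y = linext ?BB (\<lambda>P. linext ?I (F P) y) z" for z y
    unfolding tensor_act_def
  proof (intro linext_cong, clarify, intro linext_cong, clarify)
    fix a b a' b' i j assume "(a, b) \<in> B" "(a', b') \<in> B" "i \<in> idx V" "j \<in> idx W"
    then show "tens (act V (bvec (a, b)) (bvec i)) (act W (bvec (a', b')) (bvec j)) = F ((a, b), (a', b')) (i, j)"
      by (simp add: F_def tensor_act_tens
          flip: tens_bvec [of "(a, b)" "(a', b')"] tens_bvec [of i j])
  qed
  have basis: "linext ?BB (\<lambda>P. F P ac) (?m P P') = linext ?I (F P) (F P' ac)"
    if P: "P \<in> ?BB" "P' \<in> ?BB" and ac: "ac \<in> ?I" for P P' ac
  proof -
    obtain p r p' r' a c where eq: "P = (p, r)" "P' = (p', r')" "ac = (a, c)"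
      by (cases P, cases P', cases ac)
    have in_B: "p \<in> B" "r \<in> B" "p' \<in> B" "r' \<in> B" "a \<in> idx V" "c \<in> idx W" using P ac eq by auto
    have "linext ?BB (\<lambda>P. F P ac) (?m P P') = linext ?BB (\<lambda>P. linext ?I (F P) (bvec ac)) (?m P P')"
      using ac fin' by (simp add: linext_bvec)
    also have "\<dots> = tensor_act (?m P P') (bvec ac)" by (simp add: exp)
    also have "\<dots> = tens (act V (bvec p \<otimes>\<^bsub>uq_alg q d\<^esub> bvec p') (bvec a))
        (act W (bvec r \<otimes>\<^bsub>uq_alg q d\<^esub> bvec r') (bvec c))"
      using in_B by (simp add: eq tensor_act_tens uq_mult_cspace flip: tens_bvec)
    also have "\<dots> = tens (act V (bvec p) (act V (bvec p') (bvec a)))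
        (act W (bvec r) (act W (bvec r') (bvec c)))"
      using in_B by (simp add: left_moduleD(8) [OF V] left_moduleD(8) [OF W] uq_carrier)
    also have "\<dots> = tensor_act (bvec P) (F P' ac)"
      using in_B by (simp add: eq F_def tensor_act_tens act_cspace flip: tens_bvec)
    also have "\<dots> = linext ?I (F P) (F P' ac)"
      using P fin' by (simp add: exp linext_bvec)
    finally show ?thesis .
  qed
  have "tensor_act (z \<otimes>\<^bsub>uq_tensor_alg q d\<^esub> z') x =
      linext ?BB (\<lambda>P. linext ?BB (\<lambda>P'. linext ?BB (\<lambda>P. linext ?I (F P) x) (?m P P')) z') z"
    by (simp add: exp uq_tensor_alg_def tensor_alg_def linext_linext)
  also have "\<dots> = linext ?BB (\<lambda>P. linext ?BB (\<lambda>P'. linext ?I (\<lambda>ac. linext ?BB (\<lambda>P. F P ac) (?m P P')) x) z') z"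
    by (simp only: linext_swap [of "B \<times> B" "idx V \<times> idx W"])
  also have "\<dots> = linext ?BB (\<lambda>P. linext ?BB (\<lambda>P'. linext ?I (\<lambda>ac. linext ?I (F P) (F P' ac)) x) z') z"
    by (intro linext_cong basis)
  also have "\<dots> = tensor_act z (tensor_act z' x)"
    by (simp only: exp linext_linext)
  finally show ?thesis .
qed

lemma tensor_act_pow:
  assumes x: "x \<in> cspace (idx V \<times> idx W)"
  shows "tensor_act (z [^]\<^bsub>uq_tensor_alg q d\<^esub> (n::nat)) x = (tensor_act z ^^ n) x"
  using x
proof (induction n arbitrary: x)
  case 0
  have one: "\<one>\<^bsub>uq_alg q d\<^esub> \<in> cspace B"
    using d by (simp add: uq_alg_def uq_basis_def)
  have "tensor_act \<one>\<^bsub>uq_tensor_alg q d\<^esub> (bvec ac) = bvec ac" if mem: "ac \<in> idx V \<times> idx W" for ac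
  proof -
    obtain a c where ac: "ac = (a, c)" "a \<in> idx V" "c \<in> idx W" using mem by auto
    have "\<one>\<^bsub>uq_tensor_alg q d\<^esub> = tens \<one>\<^bsub>uq_alg q d\<^esub> \<one>\<^bsub>uq_alg q d\<^esub>"
      by (simp add: uq_tensor_alg_def tensor_alg_def)
    then show ?thesis
      using ac one left_moduleD(7) [OF V] left_moduleD(7) [OF W]
      by (simp add: tensor_act_tens flip: tens_bvec)
  qed
  then have "tensor_act \<one>\<^bsub>uq_tensor_alg q d\<^esub> (linext (idx V \<times> idx W) bvec x) = linext (idx V \<times> idx W) bvec x"
    using fin by (simp add: linear_op_apply_linext [OF tensor_act_linear] cong: linext_cong)
  then show ?case using 0 fin by (simp add: linext_id)
next
  case (Suc n)
  then show ?case
    by (simp add: tensor_act_mult tensor_act_cspace funpow_swap1)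
qed

text \<open>The comultiplication sends \<open>E\<^sup>a K\<^sup>b\<close> to \<open>\<Delta>(E)\<^sup>a \<Delta>(K)\<^sup>b\<close>, so \<open>V \<otimes> W\<close> has the shape required by
  \<open>operators_module\<close>. That lemma reduces the module axioms to the relations between the two operators
  \<open>\<Delta>(E)\<close> and \<open>\<Delta>(K)\<close>.\<close>

lemma act_uq_tensor_operators:
  assumes x: "x \<in> cspace (idx V \<times> idx W)"
  shows "act (uq_tensor q d V W) h x = linext B (\<lambda>(a, b).
    (tensor_act (uq_comult_E q d) ^^ a) ((tensor_act uq_comult_K ^^ b) x)) h"
proof -
  have "(tensor_act uq_comult_K ^^ b) x \<in> cspace (idx V \<times> idx W)" for b
    using x by (induction b) (simp_all add: tensor_act_cspace)
  with x show ?thesis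
    by (simp only: act_uq_tensor)
      (simp add: uq_comult_def linear_op_apply_linext [OF tensor_act_linear_alg]
        split_def tensor_act_mult tensor_act_pow)
qed

end

section \<open>The decomposition\<close>

text \<open>With \<open>t = min u v\<close> and \<open>N = u + v\<close> this is the dimension count \<open>(u + 1) (v + 1)\<close>; with \<open>t = e\<close>, for
  which \<open>N + 1 - t = d\<close>, it shows that \<open>e + 1\<close> strings of \<open>d\<close> vectors contain as many vectors as strings
  of \<open>u + v - 2l + 1\<close> vectors for \<open>l \<le> e\<close> would.\<close>

lemma sum_string_lengths:
  "2 * t \<le> N \<Longrightarrow> (\<Sum>l = 0..t. N - 2 * l + 1) = (t + 1) * (N + 1 - t)" for t N :: nat
proof (induction t)
  case (Suc t)
  then have "(\<Sum>l = 0..Suc t. N - 2 * l + 1) = (t + 1) * (N + 1 - t) + (N - 2 * Suc t + 1)"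
    by simp
  moreover obtain k where "N = 2 * Suc t + k" using Suc.prems by (auto simp: le_iff_add)
  ultimately show ?case by (simp add: algebra_simps)
qed simp

locale indec_tensor =
  fixes q :: complex and d u v :: nat and i j :: int
  assumes d: "d > 1" and q_order: "q ^ (2 * d) = 1" "\<And>k. 0 < k \<Longrightarrow> k < d \<Longrightarrow> q ^ (2 * k) \<noteq> 1"
    and u: "u < d" and v: "v < d"
begin

lemma q_nz: "q \<noteq> 0"
  using q_order(1) d by (auto simp: power_0_left)

sublocale tensor_grid "q\<^sup>2" "q powi (2 * j)" u v d
  using q_order q_nz u v by unfold_locales (auto simp flip: power_mult)

lemma raise_bvec:
  assumes "a \<le> u" "b \<le> v"
  shows "raise (bvec (a, b)) = vadd (if b < v then bvec (a, b + 1) else vzero)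
    (if a < u then vscale (q powi (2 * j) * (q\<^sup>2) ^ b) (bvec (a + 1, b)) else vzero)"
proof (rule ext, clarify)
  fix a' b'
  show "raise (bvec (a, b)) (a', b') = vadd (if b < v then bvec (a, b + 1) else vzero)
    (if a < u then vscale (q powi (2 * j) * (q\<^sup>2) ^ b) (bvec (a + 1, b)) else vzero) (a', b')"
    using assms unfolding raise_def
    by (cases a'; cases b') (auto simp: vadd_def vscale_def vzero_def bvec_def)
qed

sublocale two_modules q d "indec q d i u" "indec q d j v"
  using d q_order(1) u v by unfold_locales (auto intro: indec_module)

lemma idx_indec: "idx (indec q d i' u') = {0..u'}"
  by (simp add: indec_def)

lemma q_weight: "q powi (2 * (m + int s)) = q powi (2 * m) * (q\<^sup>2) ^ s"
proof (induction s)
  case (Suc s)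
  show ?case unfolding weight_Suc [OF q_nz] Suc by simp
qed simp

lemma tensor_act_E:
  assumes "x \<in> cspace grid"
  shows "tensor_act (uq_comult_E q d) x = raise x"
proof -
  have one: "\<one>\<^bsub>uq_alg q d\<^esub> \<in> cspace B" using d by (simp add: uq_alg_def uq_basis_def)
  have "tensor_act (uq_comult_E q d) (bvec ab) = raise (bvec ab)" if mem: "ab \<in> grid" for ab
  proof -
    obtain a b where ab: "ab = (a, b)" "a \<le> u" "b \<le> v" using mem by auto
    have bv: "bvec a \<in> cspace {0..u}" "bvec b \<in> cspace {0..v}" using ab by simp_all
    have "tensor_act (uq_comult_E q d) (bvec ab) =
        vadd (tens (bvec a) (act (indec q d j v) uq_E (bvec b)))
          (tens (act (indec q d i u) uq_E (bvec a)) (act (indec q d j v) uq_K (bvec b)))"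
      using tensor_act_linear_alg one bv uq_gen_carrier [OF d] left_moduleD(7) [OF V]
      by (simp add: ab uq_comult_E_def linear_op_def tensor_act_tens idx_indec space_def flip: tens_bvec)
    also have "\<dots> = vadd (if b < v then bvec (a, b + 1) else vzero)
        (if a < u then vscale (q powi (2 * j) * (q\<^sup>2) ^ b) (bvec (a + 1, b)) else vzero)"
      unfolding indec_act_E [OF d ab(2)] indec_act_E [OF d ab(3)] indec_act_K [OF d ab(3)] q_weight
      by (simp add: tens_vscale tens_bvec tens_vzero) (simp add: vscale_def vzero_def)
    also have "\<dots> = raise (bvec ab)"
      using ab by (simp add: raise_bvec)
    finally show ?thesis .
  qed
  then have "linext grid (\<lambda>ab. tensor_act (uq_comult_E q d) (bvec ab)) x = linext grid (\<lambda>ab. raise (bvec ab)) x"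
    by (intro linext_cong)
  then have "tensor_act (uq_comult_E q d) (linext grid bvec x) = raise (linext grid bvec x)"
    by (simp add: linear_op_apply_linext [OF tensor_act_linear] raise_linext)
  then show ?thesis using assms by (simp add: linext_id)
qed

lemma tensor_act_K:
  assumes "x \<in> cspace grid"
  shows "tensor_act uq_comult_K x = (\<lambda>(a, b). q powi (2 * (i + j + int (a + b))) * x (a, b))"
proof -
  let ?T = "\<lambda>x :: nat \<times> nat \<Rightarrow> complex. (\<lambda>(a, b). q powi (2 * (i + j + int (a + b))) * x (a, b))"
  have "tensor_act uq_comult_K (bvec ab) = ?T (bvec ab)" if mem: "ab \<in> grid" for ab
  proof -
    obtain a b where ab: "ab = (a, b)" "a \<le> u" "b \<le> v" using mem by auto
    have bv: "bvec a \<in> cspace {0..u}" "bvec b \<in> cspace {0..v}" using ab by simp_all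
    have "tensor_act uq_comult_K (bvec ab) =
        tens (act (indec q d i u) uq_K (bvec a)) (act (indec q d j v) uq_K (bvec b))"
      using bv uq_gen_carrier [OF d]
      by (simp add: ab uq_comult_K_def tensor_act_tens idx_indec flip: tens_bvec)
    also have "\<dots> = ?T (bvec ab)"
    proof -
      have "q powi (2 * (i + int a)) * q powi (2 * (j + int b)) = q powi (2 * (i + j + int (a + b)))"
        using q_nz by (simp add: algebra_simps flip: power_int_add)
      then show ?thesis
        unfolding indec_act_K [OF d ab(2)] indec_act_K [OF d ab(3)]
        by (auto simp: ab tens_vscale tens_bvec) (auto simp: vscale_def bvec_def fun_eq_iff mult.commute)
    qed
    finally show ?thesis .
  qed
  then have "linext grid (\<lambda>ab. tensor_act uq_comult_K (bvec ab)) x = linext grid (\<lambda>ab. ?T (bvec ab)) x"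
    by (intro linext_cong)
  moreover have "linear_op ?T"
    by (auto simp: linear_op_def vadd_def vscale_def fun_eq_iff algebra_simps)
  ultimately have "tensor_act uq_comult_K (linext grid bvec x) = ?T (linext grid bvec x)"
    using linear_op_apply_linext [OF \<open>linear_op ?T\<close>, of grid bvec x]
    by (simp add: linear_op_apply_linext [OF tensor_act_linear])
  then show ?thesis using assms by (simp add: linext_id)
qed

lemma space_tensor: "space (uq_tensor q d (indec q d i u) (indec q d j v)) = cspace grid"
  by (simp add: space_def idx_uq_tensor idx_indec)

lemma raise_pow_cspace: "x \<in> cspace grid \<Longrightarrow> (raise ^^ k) x \<in> cspace grid"
  by (cases k) (simp_all add: raise_cspace)

lemma tensor_act_E_pow:
  assumes "x \<in> cspace grid"
  shows "(tensor_act (uq_comult_E q d) ^^ k) x = (raise ^^ k) x"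
  by (induction k) (simp_all add: tensor_act_E raise_pow_cspace assms)

text \<open>The relation \<open>E\<^sup>d = 0\<close> on the tensor product is \<open>raise_pow_d\<close>.\<close>

lemma tensor_indec_module: "is_left_module (uq_alg q d) (uq_tensor q d (indec q d i u) (indec q d j v))"
proof (rule operators_module [where E = "tensor_act (uq_comult_E q d)" and K = "tensor_act uq_comult_K"])
  fix x assume "x \<in> space (uq_tensor q d (indec q d i u) (indec q d j v))"
  then have x: "x \<in> cspace grid" by (simp add: space_tensor)
  have sp: "tensor_act z x \<in> cspace grid" for z x
    using tensor_act_cspace by (simp add: idx_indec)
  then show "tensor_act (uq_comult_E q d) x \<in> space (uq_tensor q d (indec q d i u) (indec q d j v))"
    "tensor_act uq_comult_K x \<in> space (uq_tensor q d (indec q d i u) (indec q d j v))"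
    by (simp_all add: space_tensor)
  show "(tensor_act (uq_comult_E q d) ^^ d) x = vzero"
    using x by (simp add: tensor_act_E_pow raise_pow_d)
  have pow: "(tensor_act uq_comult_K ^^ k) x \<in> cspace grid" for k
    using x sp by (cases k) simp_all
  have "(tensor_act uq_comult_K ^^ k) x (a, b) = (q powi (2 * (i + j + int (a + b)))) ^ k * x (a, b)" for k a b
    using pow by (induction k) (simp_all add: tensor_act_K)
  moreover note weight_pow_ord [OF q_order(1)]
  ultimately show "(tensor_act uq_comult_K ^^ d) x = x"
    by (intro ext) (clarify, simp only: mult_1)
  show "tensor_act uq_comult_K (tensor_act (uq_comult_E q d) x) =
      vscale (q\<^sup>2) (tensor_act (uq_comult_E q d) (tensor_act uq_comult_K x))"
  proof -
    define \<omega> where "\<omega> s = q powi (2 * (i + j + int s))" for s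
    have K: "tensor_act uq_comult_K y = (\<lambda>(a, b). \<omega> (a + b) * y (a, b))" if "y \<in> cspace grid" for y
      using tensor_act_K [OF that] by (simp add: \<omega>_def)
    have w: "\<omega> (Suc s) = q\<^sup>2 * \<omega> s" for s
      unfolding \<omega>_def by (rule weight_Suc [OF q_nz])
    have Kx: "(\<lambda>(a, b). \<omega> (a + b) * x (a, b)) \<in> cspace grid"
      using x by (auto simp: cspace_def)
    show ?thesis
    proof (rule ext, clarify)
      fix a b
      show "tensor_act uq_comult_K (tensor_act (uq_comult_E q d) x) (a, b) =
        vscale (q\<^sup>2) (tensor_act (uq_comult_E q d) (tensor_act uq_comult_K x)) (a, b)"
        unfolding tensor_act_E [OF x] K [OF x] K [OF raise_cspace] tensor_act_E [OF Kx]
        by (cases a; cases b) (simp_all add: raise_def vscale_def w, simp_all add: algebra_simps)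
    qed
  qed
  show "act (uq_tensor q d (indec q d i u) (indec q d j v)) h x = linext (uq_basis d) (\<lambda>(a, b).
    (tensor_act (uq_comult_E q d) ^^ a) ((tensor_act uq_comult_K ^^ b) x)) h" for h
    using act_uq_tensor_operators x by (simp add: idx_indec)
qed (use d in \<open>simp_all add: tensor_act_linear idx_uq_tensor idx_indec\<close>)

text \<open>The exponent \<open>r\<close> of the last nonzero power of \<open>E\<close> on the string, one less than its number of
  vectors. The condition \<open>l + (d - 1) \<le> u + v\<close> is \<open>l \<le> e\<close>, in a form that makes sense also for
  \<open>u + v < d - 1\<close>, where no projective summand occurs.\<close>

definition string_length :: "nat \<Rightarrow> nat" where
  "string_length l = (if l + (d - 1) \<le> u + v then d - 1 else u + v - 2 * l)"

definition string_start :: "nat \<Rightarrow> nat \<times> nat \<Rightarrow> complex" where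
  "string_start l = (if l + (d - 1) \<le> u + v then bvec (l, 0) else lowest l)"

lemma string_start_homog: "l \<le> min u v \<Longrightarrow> homog l (string_start l)"
  using lowest_homog [of l] by (auto simp: string_start_def homog_def bvec_def)

lemma string_end_nz: "l \<le> min u v \<Longrightarrow> (raise ^^ string_length l) (string_start l) \<noteq> vzero"
  using long_string [of l] short_string(1) [of l] u v
  by (auto simp: string_start_def string_length_def)

lemma string_end: "l \<le> min u v \<Longrightarrow> (raise ^^ Suc (string_length l)) (string_start l) = vzero"
proof -
  assume l: "l \<le> min u v"
  show ?thesis
  proof (cases "l + (d - 1) \<le> u + v")
    case True
    then have "Suc (string_length l) = d" using d by (simp add: string_length_def)
    then show ?thesis using raise_pow_d [OF homog_cspace [OF string_start_homog [OF l]]] by metis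
  next
    case False
    then show ?thesis using short_string(2) [of l] l by (auto simp: string_start_def string_length_def)
  qed
qed

text \<open>Long strings end in degree \<open>l + d - 1\<close>, short ones in degree \<open>u + v - l < d - 1\<close>.\<close>

lemma string_ends_distinct:
  assumes "l \<le> min u v" "l' \<le> min u v" "l + string_length l = l' + string_length l'"
  shows "l = l'"
  using assms unfolding string_length_def by (auto split: if_splits)

lemma sum_string_length: "(\<Sum>l = 0..min u v. string_length l + 1) = (u + 1) * (v + 1)"
proof -
  let ?m = "min u v"
  have total: "(\<Sum>l = 0..?m. u + v - 2 * l + 1) = (u + 1) * (v + 1)"
    by (subst sum_string_lengths) (auto simp: min_def)
  show ?thesis
  proof (cases "d - 1 \<le> u + v")
    case False
    then have "string_length l = u + v - 2 * l" for l by (auto simp: string_length_def)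
    then show ?thesis using total by simp
  next
    case True
    define e where "e = u + v - (d - 1)"
    have e: "e \<le> ?m" "d - 1 = u + v - e" "e \<le> u + v" using True u v by (auto simp: e_def)
    have split: "(\<Sum>l = 0..?m. f l) = (\<Sum>l = 0..e. f l) + (\<Sum>l = e + 1..?m. f l)" for f :: "nat \<Rightarrow> nat"
      using e(1) by (subst sum.union_disjoint [symmetric]) (auto intro: sum.cong)
    have "string_length l = u + v - e" if "l \<in> {0..e}" for l
      using that True e by (simp add: string_length_def e_def)
    then have "(\<Sum>l = 0..e. string_length l + 1) = (\<Sum>l = 0..e. u + v - e + 1)"
      by (intro sum.cong) simp_all
    also have "\<dots> = (e + 1) * (u + v + 1 - e)" using e(3) by (simp add: Suc_diff_le)
    also have "\<dots> = (\<Sum>l = 0..e. u + v - 2 * l + 1)"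
      using e(1) by (intro sum_string_lengths [symmetric]) simp
    finally have "(\<Sum>l = 0..?m. string_length l + 1) =
        (\<Sum>l = 0..e. u + v - 2 * l + 1) + (\<Sum>l = e + 1..?m. string_length l + 1)"
      by (simp only: split [of "\<lambda>l. string_length l + 1"])
    also have "(\<Sum>l = e + 1..?m. string_length l + 1) = (\<Sum>l = e + 1..?m. u + v - 2 * l + 1)"
      using e by (intro sum.cong) (auto simp: string_length_def)
    finally show ?thesis using total by (simp only: split [of "\<lambda>l. u + v - 2 * l + 1"])
  qed
qed

text \<open>Both cases of the theorem at once: the ends of the strings are nonzero and homogeneous of different
  degrees, hence independent, and \<open>sum_string_length\<close> shows that there are enough vectors.\<close>

theorem tensor_iso_strings:
  "isomorphic_modules (uq_alg q d) (uq_tensor q d (indec q d i u) (indec q d j v))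
     (direct_sum {0..min u v} (\<lambda>l. indec q d (i + j + int l) (string_length l)))"
proof (rule string_decomposition [where w = string_start])
  let ?V = "uq_tensor q d (indec q d i u) (indec q d j v)"
  have E: "(act ?V uq_E ^^ k) x = (raise ^^ k) x" if "x \<in> cspace grid" for k x
    by (simp add: act_uq_tensor uq_comult_generators [OF d] tensor_act_E_pow that)
  have w: "string_start l \<in> cspace grid" if "l \<in> {0..min u v}" for l
    using that by (intro homog_cspace [OF string_start_homog]) simp
  show "is_left_module (uq_alg q d) ?V" by (rule tensor_indec_module)
  show "(\<Sum>l\<in>{0..min u v}. string_length l + 1) = card (idx ?V)"
    by (simp only: sum_string_length) (simp add: idx_uq_tensor idx_indec)
  show "\<forall>l\<in>{0..min u v}. c l = 0"
    if "linext {0..min u v} (\<lambda>l. (act ?V uq_E ^^ string_length l) (string_start l)) c = vzero" for c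
  proof
    fix l assume l: "l \<in> {0..min u v}"
    then obtain t where t: "(raise ^^ string_length l) (string_start l) t \<noteq> 0"
      using string_end_nz [of l] by (auto simp: vzero_def fun_eq_iff)
    have "(raise ^^ string_length l') (string_start l') t = 0"
      if "l' \<in> {0..min u v}" "l' \<noteq> l" for l'
    proof (rule ccontr)
      assume "(raise ^^ string_length l') (string_start l') t \<noteq> 0"
      moreover obtain a b where "t = (a, b)" by (cases t)
      ultimately have "a + b = l' + string_length l'" "a + b = l + string_length l"
        using t l that raise_pow_homog [OF string_start_homog, of l "string_length l"]
          raise_pow_homog [OF string_start_homog, of l' "string_length l'"]
        unfolding homog_def by (metis atLeastAtMost_iff)+
      then show False using string_ends_distinct [of l' l] l that by auto
    qed
    then have "linext {0..min u v} (\<lambda>l. (raise ^^ string_length l) (string_start l)) c t =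
      (\<Sum>l'\<in>{0..min u v}. if l' = l then c l * (raise ^^ string_length l) (string_start l) t else 0)"
      unfolding linext_def by (intro sum.cong) auto
    moreover have "linext {0..min u v} (\<lambda>l. (raise ^^ string_length l) (string_start l)) c = vzero"
    proof -
      have "linext {0..min u v} (\<lambda>l. (act ?V uq_E ^^ string_length l) (string_start l)) c =
          linext {0..min u v} (\<lambda>l. (raise ^^ string_length l) (string_start l)) c"
        by (intro linext_cong E w)
      with that show ?thesis by simp
    qed
    ultimately show "c l = 0" using l t by (simp add: vzero_def)
  qed
  fix l assume l: "l \<in> {0..min u v}"
  show "string_start l \<in> space ?V" using w [OF l] by (simp add: space_tensor)
  show "act ?V uq_K (string_start l) = vscale (q powi (2 * (i + j + int l))) (string_start l)"
  proof (rule ext, clarify)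
    fix a b
    have "homog l (string_start l)" using l by (intro string_start_homog) simp
    then have "string_start l (a, b) = 0 \<or> a + b = l" unfolding homog_def by blast
    then show "act ?V uq_K (string_start l) (a, b) =
        vscale (q powi (2 * (i + j + int l))) (string_start l) (a, b)"
      unfolding act_uq_tensor uq_comult_generators(2) [OF d] tensor_act_K [OF w [OF l]] vscale_def
      by auto
  qed
  show "(act ?V uq_E ^^ Suc (string_length l)) (string_start l) = vzero"
    using string_end [of l] l unfolding E [OF w [OF l]] by simp
  show "string_length l < d" using d l u v by (auto simp: string_length_def)
qed (use d q_order in auto)

end

theorem theorem3p1:
  fixes q :: complex and n d u v :: nat and i j :: int
  assumes "primitive_root_unity n q"
    and "n \<ge> 3" and "n \<noteq> 4"
    and "d = uq_ord n"
    and "u \<le> d - 1" and "v \<le> d - 1"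
  shows "(u + v \<le> d - 1 \<longrightarrow>
           isomorphic_modules (uq_alg q d)
             (uq_tensor q d (indec q d i u) (indec q d j v))
             (direct_sum {0..min u v} (\<lambda>l. indec q d (i + j + int l) (u + v - 2 * l)))) \<and>
         (u + v \<ge> d - 1 \<longrightarrow>
           (let e = u + v - (d - 1) in
           isomorphic_modules (uq_alg q d)
             (uq_tensor q d (indec q d i u) (indec q d j v))
             (direct_sum2
               (direct_sum {0..e} (\<lambda>l. proj_indec q d (i + j + int l)))
               (direct_sum {e+1..min u v} (\<lambda>l. indec q d (i + j + int l) (u + v - 2 * l))))))"
proof -
  have root: "q ^ n = 1" "\<And>m. 0 < m \<Longrightarrow> m < n \<Longrightarrow> q ^ m \<noteq> 1"
    using assms(1) by (auto simp: primitive_root_unity_def)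
  have d: "d > 1" using assms(2-4) by (auto simp: uq_ord_def split: if_splits elim!: evenE)
  have q1: "q ^ (2 * d) = 1"
    using root(1) assms(4) by (auto simp: uq_ord_def mult.commute [of 2] power_mult)
  \<comment> \<open>For odd \<open>n\<close> the exponent \<open>2k\<close> can exceed \<open>n\<close>, but \<open>2k - n\<close> is odd, hence nonzero, and less than \<open>n\<close>.\<close>
  have q2: "q ^ (2 * k) \<noteq> 1" if k: "0 < k" "k < d" for k
  proof (cases "even n")
    case True
    then show ?thesis using k assms(4) by (intro root) (auto simp: uq_ord_def)
  next
    case False
    then have "d = n" using assms(4) by (simp add: uq_ord_def)
    show ?thesis
    proof (cases "2 * k < n")
      case True
      then show ?thesis using k by (intro root) auto
    next
      case ge: False
      have "2 * k \<noteq> n" using False by auto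
      then have "q ^ (2 * k - n) \<noteq> 1" using ge k \<open>d = n\<close> by (intro root) auto
      moreover have "q ^ (2 * k) = q ^ (2 * k - n) * q ^ n"
        using ge by (simp flip: power_add)
      ultimately show ?thesis using root(1) by simp
    qed
  qed
  interpret indec_tensor q d u v i j
    using d q1 q2 assms(5,6) by unfold_locales auto
  let ?M = "\<lambda>l. indec q d (i + j + int l) (string_length l)"
  have cong: "direct_sum I f = direct_sum I g" if "\<And>l. l \<in> I \<Longrightarrow> f l = g l"
    for I :: "nat set" and f g :: "nat \<Rightarrow> (nat \<times> nat, nat) fdmod"
    using that by (auto simp: direct_sum_def fun_eq_iff intro!: Sigma_cong)
  have mod: "is_left_module (uq_alg q d) (?M l)" if "l \<le> min u v" for l
    using d q1 u v that by (intro indec_module) (auto simp: string_length_def)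
  show ?thesis
  proof (intro conjI impI)
    assume le: "u + v \<le> d - 1"
    have "direct_sum {0..min u v} ?M =
        direct_sum {0..min u v} (\<lambda>l. indec q d (i + j + int l) (u + v - 2 * l))"
    proof (rule cong)
      fix l
      have "string_length l = u + v - 2 * l" using le by (auto simp: string_length_def)
      then show "?M l = indec q d (i + j + int l) (u + v - 2 * l)" by simp
    qed
    then show "isomorphic_modules (uq_alg q d) (uq_tensor q d (indec q d i u) (indec q d j v))
        (direct_sum {0..min u v} (\<lambda>l. indec q d (i + j + int l) (u + v - 2 * l)))"
      using tensor_iso_strings by simp
  next
    assume ge: "u + v \<ge> d - 1"
    define e where "e = u + v - (d - 1)"
    have e: "e \<le> min u v" using ge u v by (auto simp: e_def)
    have "{0..e} \<union> {e + 1..min u v} = {0..min u v}" using e by auto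
    then have "isomorphic_modules (uq_alg q d) (direct_sum {0..min u v} ?M)
        (direct_sum2 (direct_sum {0..e} ?M) (direct_sum {e + 1..min u v} ?M))"
      using direct_sum_Un [of "{0..e}" "{e + 1..min u v}" "uq_alg q d" ?M] mod by auto
    moreover have "direct_sum {0..e} ?M = direct_sum {0..e} (\<lambda>l. proj_indec q d (i + j + int l))"
      using ge by (intro cong) (auto simp: string_length_def proj_indec_def e_def)
    moreover have "direct_sum {e + 1..min u v} ?M =
        direct_sum {e + 1..min u v} (\<lambda>l. indec q d (i + j + int l) (u + v - 2 * l))"
      by (intro cong) (auto simp: string_length_def e_def)
    ultimately show "let e = u + v - (d - 1) in
        isomorphic_modules (uq_alg q d) (uq_tensor q d (indec q d i u) (indec q d j v))
          (direct_sum2 (direct_sum {0..e} (\<lambda>l. proj_indec q d (i + j + int l)))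
            (direct_sum {e + 1..min u v} (\<lambda>l. indec q d (i + j + int l) (u + v - 2 * l))))"
      unfolding Let_def e_def [symmetric] using isomorphic_modules_trans [OF tensor_iso_strings] by simp
  qed
qed

end
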